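(* Let $\mathcal G$ be an equilateral metric graph (all edges of length $1$) and let $H=-\Delta+V$ with a relatively $-\Delta$-bounded potential $V=(V_{\mathsf e})\in L^1_{\mathrm{loc}}$ with relative bound $<1$ that is the same on every edge. Let $X_{\mathrm c}$ be one of $C_0(\mathcal G)$, $L^p(\mathcal G)$ ($1\le p<\infty$), $BUC(\mathcal G)$ and let $X_{\mathrm d}$ be the corresponding discrete space. For $\lambda\in\rho(H^D)$ we have $\lambda\in\sigma_p(H_{X_{\mathrm c}})$ if and only if the Floquet discriminant $D(\lambda)=\tfrac12(c_\lambda(1)+s_\lambda'(1))$ satisfies $D(\lambda)\in\sigma_p(P_{X_{\mathrm d}})$.
   Context: **Metric graph.** $\mathcal G$ is the metric graph over a countable, oriented, connected graph with vertex set $\mathcal V$ and edge set $\mathcal E$, without self-loops, uniformly locally finite: writing $\mathcal E_{\mathsf v}$ for the set of edges incident to $\mathsf v$, $\sup_{\mathsf v}|\mathcal E_{\mathsf v}|<\infty$. Every edge $\mathsf e$ has an initial vertex $i(\mathsf e)$ and a terminal vertex $t(\mathsf e)$ and is identified with $(0,1)$ ($0\leftrightarrow i(\mathsf e)$, $1\leftrightarrow t(\mathsf e)$). $\mathcal G$ carries the natural path metric. Each edge has a conductivity $c(\mathsf e)>0$, and $c(\mathsf v):=\sum_{\mathsf e\in\mathcal E_{\mathsf v}}c(\mathsf e)$. **Spaces.** $L^p(\mathcal G)$: with respect to the measure whose restriction to $\mathsf e$ is $c(\mathsf e)$ times Lebesgue measure; $\ell^p(\mathcal V)$: with norm $(\sum_{\mathsf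 v}|z(\mathsf v)|^pc(\mathsf v))^{1/p}$; $C_0(\mathcal G)$, $BUC(\mathcal G)$ (bounded uniformly continuous functions), $c_0(\mathcal V)$, $\ell^\infty(\mathcal V)$: unweighted sup-norm. Correspondence $X_{\mathrm c}\leftrightarrow X_{\mathrm d}$: $C_0(\mathcal G)\leftrightarrow c_0(\mathcal V)$, $L^p(\mathcal G)\leftrightarrow\ell^p(\mathcal V)$, $BUC(\mathcal G)\leftrightarrow\ell^\infty(\mathcal V)$. **Operators.** $H_{X_{\mathrm c}}$ acts edgewise as $u\mapsto-u''+Vu$ on $\{u\in X_{\mathrm c}:Hu\in X_{\mathrm c},\ u\in C(\mathcal G),\ \sum_{\mathsf e\in\mathcal E_{\mathsf v}}\frac{\partial u_{\mathsf e}}{\partial n_{\mathsf e}}(\mathsf v)=0\ \forall\mathsf v\}$, where $\frac{\partial u_{\mathsf e}}{\partial n_{\mathsf e}}(\mathsf v)=c(\mathsf e)u_{\mathsf e}'(0^+)$ if $\mathsf v=i(\mathsf e)$ and $-c(\mathsf e)u_{\mathsf e}'(1^-)$ if $\mathsf v=t(\mathsf e)$; $C(\mathcal G)$ denotes continuous functions (in particular at vertices). $H^D$ is the operator $-\frac{d^2}{dx^2}+V_{\mathsf e}$ on $[0,1]$ with Dirichlet conditions $f(0)=f(1)=0$. $c_\lambda,s_\lambda$ are the solutions on $[0,1]$ of $-\psi''+V_{\mathsf e}\psi=\lambda\psi$ with $c_\lambda(0)=1,c_\lambda'(0)=0$, $s_\lambda(0)=0,s_\lambda'(0)=1$. $P_{X_{\mathrm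 d}}$ acts on $X_{\mathrm d}$ by $(P_{X_{\mathrm d}}z)(\mathsf v)=\sum_{\mathsf e\in\mathcal E_{\mathsf v}}\frac{c(\mathsf e)}{c(\mathsf v)}z(\mathsf v_{\mathsf e})$, where $\mathsf v_{\mathsf e}$ is the endpoint of $\mathsf e$ other than $\mathsf v$. $\sigma_p$ denotes the set of eigenvalues.
   Formalization: Added: the common potential is symmetric on the edge (V(1-x)=V(x) a.e.), or at each vertex outgoing and incoming conductivities have equal sums. Without this the claim fails, e.g. one edge with V(x)=x and λ the lowest Neumann eigenvalue: D(λ)>1 while P has eigenvalues ±1. *)

theory Defs
  imports "HOL-Analysis.Analysis" "Graph_Theory.Digraph_Component"
begin

section \<open>Weighted graphs\<close>

text \<open>
  The orientation of an edge \<open>e\<close> is \<open>i(e) = tail G e\<close>, \<open>t(e) = head G e\<close>. Parallel edges are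
  allowed; connectedness refers to the underlying undirected graph. An edge is required to exist:
  otherwise the graph is a single vertex with \<open>c(v) = 0\<close>, and neither the spaces nor \<open>P\<close> make sense.
\<close>

definition incident :: "('v, 'e) pre_digraph \<Rightarrow> 'v \<Rightarrow> 'e set" where
  "incident G v = {e \<in> arcs G. tail G e = v \<or> head G e = v}"

locale weighted_graph = loopfree_digraph G for G :: "('v, 'e) pre_digraph" +
  fixes c :: "'e \<Rightarrow> real"
  assumes countable_verts: "countable (verts G)"
    and countable_arcs: "countable (arcs G)"
    and connected_graph: "Digraph_Component.connected G"
    and arcs_nonempty: "arcs G \<noteq> {}"
    and uniformly_locally_finite:
      "\<exists>N. \<forall>v \<in> verts G. finite (incident G v) \<and> card (incident G v) \<le> N"
    and conductivity_pos: "\<And>e. e \<in> arcs G \<Longrightarrow> 0 < c e"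

definition vertex_weight :: "('v, 'e) pre_digraph \<Rightarrow> ('e \<Rightarrow> real) \<Rightarrow> 'v \<Rightarrow> real" where
  "vertex_weight G c v = (\<Sum>e \<in> incident G v. c e)"

definition opposite :: "('v, 'e) pre_digraph \<Rightarrow> 'v \<Rightarrow> 'e \<Rightarrow> 'v" where
  "opposite G v e = (if v = tail G e then head G e else tail G e)"


section \<open>The equilateral metric graph\<close>

datatype ('v, 'e) gpoint = Vertex 'v | Inner 'e real

definition points :: "('v, 'e) pre_digraph \<Rightarrow> ('v, 'e) gpoint set" where
  "points G = Vertex ` verts G \<union> {Inner e x | e x. e \<in> arcs G \<and> 0 < x \<and> x < 1}"

definition edge_point :: "('v, 'e) pre_digraph \<Rightarrow> 'e \<Rightarrow> real \<Rightarrow> ('v, 'e) gpoint" where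
  "edge_point G e x =
     (if x = 0 then Vertex (tail G e) else if x = 1 then Vertex (head G e) else Inner e x)"

text \<open>The restriction \<open>u\<^sub>e\<close> of a function on the metric graph, meaningful on \<open>[0,1]\<close>.\<close>

definition on_edge ::
  "('v, 'e) pre_digraph \<Rightarrow> (('v, 'e) gpoint \<Rightarrow> complex) \<Rightarrow> 'e \<Rightarrow> real \<Rightarrow> complex" where
  "on_edge G u e x = u (edge_point G e x)"

text \<open>Paths composed of finitely many segments, each inside one closed edge, with their length.\<close>

inductive path_length ::
  "('v, 'e) pre_digraph \<Rightarrow> ('v, 'e) gpoint \<Rightarrow> ('v, 'e) gpoint \<Rightarrow> real \<Rightarrow> bool"
  for G :: "('v, 'e) pre_digraph" where
  trivial: "p \<in> points G \<Longrightarrow> path_length G p p 0"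
| segment: "\<lbrakk>path_length G p (edge_point G e x) l; e \<in> arcs G; x \<in> {0..1}; y \<in> {0..1}\<rbrakk>
    \<Longrightarrow> path_length G p (edge_point G e y) (l + \<bar>x - y\<bar>)"

text \<open>The value outside the metric graph is fixed because \<open>Metric_space\<close> requires symmetry and
  nonnegativity on the whole type.\<close>

definition path_dist ::
  "('v, 'e) pre_digraph \<Rightarrow> ('v, 'e) gpoint \<Rightarrow> ('v, 'e) gpoint \<Rightarrow> real" where
  "path_dist G p q =
     (if p \<in> points G \<and> q \<in> points G then Inf {l. path_length G p q l} else 0)"

definition gtopology :: "('v, 'e) pre_digraph \<Rightarrow> ('v, 'e) gpoint topology" where
  "gtopology G = Metric_space.mtopology (points G) (path_dist G)"

definition continuous_on_graph ::
  "('v, 'e) pre_digraph \<Rightarrow> (('v, 'e) gpoint \<Rightarrow> complex) \<Rightarrow> bool" where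
  "continuous_on_graph G u \<longleftrightarrow> continuous_map (gtopology G) euclidean u"


section \<open>Function spaces\<close>

text \<open>\<open>L\<^sup>p(0,1)\<close>, on the level of representatives.\<close>

definition in_Lp :: "real \<Rightarrow> (real \<Rightarrow> complex) \<Rightarrow> bool" where
  "in_Lp p f \<longleftrightarrow> f \<in> borel_measurable (lebesgue_on {0..1}) \<and>
     integrable (lebesgue_on {0..1}) (\<lambda>x. norm (f x) powr p)"

definition Lp_mass :: "real \<Rightarrow> (real \<Rightarrow> complex) \<Rightarrow> real" where
  "Lp_mass p f = (LINT x | lebesgue_on {0..1}. norm (f x) powr p)"

datatype function_space = C0 | Lp real | BUC

text \<open>The real exponent in \<open>Lp p\<close> ranges over \<open>1 \<le> p < \<infinity>\<close>.\<close>

definition admissible :: "function_space \<Rightarrow> bool" where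
  "admissible X \<longleftrightarrow> (case X of Lp p \<Rightarrow> 1 \<le> p | _ \<Rightarrow> True)"

definition cspace ::
  "('v, 'e) pre_digraph \<Rightarrow> ('e \<Rightarrow> real) \<Rightarrow> function_space \<Rightarrow> (('v, 'e) gpoint \<Rightarrow> complex) set" where
  "cspace G c X = (case X of
     C0 \<Rightarrow> {u. continuous_on_graph G u \<and>
            (\<forall>\<epsilon>>0. \<exists>K. compactin (gtopology G) K \<and> (\<forall>p \<in> points G - K. norm (u p) < \<epsilon>))}
   | Lp p \<Rightarrow> {u. (\<forall>e \<in> arcs G. in_Lp p (on_edge G u e)) \<and>
            (\<lambda>e. c e * Lp_mass p (on_edge G u e)) summable_on arcs G}
   | BUC \<Rightarrow> {u. bounded (u ` points G) \<and>
            (\<forall>\<epsilon>>0. \<exists>\<delta>>0. \<forall>p \<in> points G. \<forall>q \<in> points G.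
               path_dist G p q < \<delta> \<longrightarrow> norm (u p - u q) < \<epsilon>)})"

definition cnorm ::
  "('v, 'e) pre_digraph \<Rightarrow> ('e \<Rightarrow> real) \<Rightarrow> function_space \<Rightarrow> (('v, 'e) gpoint \<Rightarrow> complex) \<Rightarrow> real" where
  "cnorm G c X u = (case X of
     Lp p \<Rightarrow> (\<Sum>\<^sub>\<infinity>e \<in> arcs G. c e * Lp_mass p (on_edge G u e)) powr (1 / p)
   | _ \<Rightarrow> (SUP p \<in> points G. norm (u p)))"

definition dspace ::
  "('v, 'e) pre_digraph \<Rightarrow> ('e \<Rightarrow> real) \<Rightarrow> function_space \<Rightarrow> ('v \<Rightarrow> complex) set" where
  "dspace G c X = (case X of
     C0 \<Rightarrow> {z. \<forall>\<epsilon>>0. finite {v \<in> verts G. \<epsilon> \<le> norm (z v)}}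
   | Lp p \<Rightarrow> {z. (\<lambda>v. norm (z v) powr p * vertex_weight G c v) summable_on verts G}
   | BUC \<Rightarrow> {z. bounded (z ` verts G)})"

text \<open>Equality almost everywhere with respect to the measure of the metric graph is equality almost
  everywhere on every edge; this decides when an expression defined edgewise represents \<open>f\<close>.\<close>

definition represents ::
  "('v, 'e) pre_digraph \<Rightarrow> (('v, 'e) gpoint \<Rightarrow> complex) \<Rightarrow> ('e \<Rightarrow> real \<Rightarrow> complex) \<Rightarrow> bool" where
  "represents G f g \<longleftrightarrow> (\<forall>e \<in> arcs G. AE x in lebesgue_on {0..1}. on_edge G f e x = g e x)"


section \<open>Operators\<close>

text \<open>Operators are given by their graphs, sets of pairs of an element of the domain and its image.\<close>

text \<open>\<open>\<psi> \<in> W\<^sup>2\<^sup>,\<^sup>1(0,1)\<close> with continuous first derivative \<open>\<psi>'\<close> and weak second derivative \<open>\<psi>''\<close>: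
  \<open>\<psi>'\<close> is the absolutely continuous primitive of the integrable function \<open>\<psi>''\<close>.\<close>

definition W21 :: "(real \<Rightarrow> complex) \<Rightarrow> (real \<Rightarrow> complex) \<Rightarrow> (real \<Rightarrow> complex) \<Rightarrow> bool" where
  "W21 \<psi> \<psi>' \<psi>'' \<longleftrightarrow>
     (\<forall>x \<in> {0..1}. (\<psi> has_vector_derivative \<psi>' x) (at x within {0..1})) \<and>
     \<psi>'' absolutely_integrable_on {0..1} \<and>
     (\<forall>x \<in> {0..1}. (\<psi>'' has_integral (\<psi>' x - \<psi>' 0)) {0..x})"

text \<open>The derivative at an endpoint \<open>v\<close> of \<open>e\<close>, pointing into the edge and weighted by \<open>c(e)\<close>; \<open>d\<close> is
  the derivative of the function along \<open>e\<close>.\<close>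

definition normal_derivative ::
  "('v, 'e) pre_digraph \<Rightarrow> ('e \<Rightarrow> real) \<Rightarrow> (real \<Rightarrow> complex) \<Rightarrow> 'e \<Rightarrow> 'v \<Rightarrow> complex" where
  "normal_derivative G c d e v =
     (if v = tail G e then of_real (c e) * d 0 else - of_real (c e) * d 1)"

definition schroedinger ::
  "('v, 'e) pre_digraph \<Rightarrow> ('e \<Rightarrow> real) \<Rightarrow> function_space \<Rightarrow> ('e \<Rightarrow> real \<Rightarrow> complex) \<Rightarrow>
   ((('v, 'e) gpoint \<Rightarrow> complex) \<times> (('v, 'e) gpoint \<Rightarrow> complex)) set" where
  "schroedinger G c X V = {(u, f). u \<in> cspace G c X \<and> f \<in> cspace G c X \<and> continuous_on_graph G u \<and>
     (\<exists>u' u''. (\<forall>e \<in> arcs G. W21 (on_edge G u e) (u' e) (u'' e)) \<and>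
        represents G f (\<lambda>e x. - u'' e x + V e x * on_edge G u e x) \<and>
        (\<forall>v \<in> verts G. (\<Sum>e \<in> incident G v. normal_derivative G c (u' e) e v) = 0))}"

definition relatively_bounded ::
  "('v, 'e) pre_digraph \<Rightarrow> ('e \<Rightarrow> real) \<Rightarrow> function_space \<Rightarrow> ('e \<Rightarrow> real \<Rightarrow> complex) \<Rightarrow> real \<Rightarrow> bool" where
  "relatively_bounded G c X V a \<longleftrightarrow>
     (\<exists>b \<ge> 0. \<forall>(u, g) \<in> schroedinger G c X (\<lambda>_ _. 0). \<exists>f \<in> cspace G c X.
        represents G f (\<lambda>e x. V e x * on_edge G u e x) \<and>
        cnorm G c X f \<le> a * cnorm G c X g + b * cnorm G c X u)"

definition transition ::
  "('v, 'e) pre_digraph \<Rightarrow> ('e \<Rightarrow> real) \<Rightarrow> function_space \<Rightarrow> (('v \<Rightarrow> complex) \<times> ('v \<Rightarrow> complex)) set" where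
  "transition G c X = {(z, w). z \<in> dspace G c X \<and> w \<in> dspace G c X \<and>
     (\<forall>v \<in> verts G. w v =
        (\<Sum>e \<in> incident G v. of_real (c e / vertex_weight G c v) * z (opposite G v e)))}"

text \<open>Eigenvalues of an operator in a space of functions on \<open>S\<close>. For the operators above elements of the
  domain are continuous, respectively functions on a discrete set, so that being nonzero at some
  point is being a nonzero element of the space.\<close>

definition point_spectrum :: "'a set \<Rightarrow> (('a \<Rightarrow> complex) \<times> ('a \<Rightarrow> complex)) set \<Rightarrow> complex set" where
  "point_spectrum S T = {\<mu>. \<exists>u. (u, \<lambda>p. \<mu> * u p) \<in> T \<and> (\<exists>p \<in> S. u p \<noteq> 0)}"


section \<open>The Dirichlet operator and the Floquet discriminant on a single edge\<close>

text \<open>\<open>H\<^sup>D\<close> is realised in \<open>L\<^sup>2(0,1)\<close>. Its resolvent kernel is bounded, so its spectrum is the same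
  in every \<open>L\<^sup>q(0,1)\<close> and in \<open>C[0,1]\<close>.\<close>

definition dirichlet_op :: "(real \<Rightarrow> complex) \<Rightarrow> ((real \<Rightarrow> complex) \<times> (real \<Rightarrow> complex)) set" where
  "dirichlet_op V = {(f, g). in_Lp 2 f \<and> in_Lp 2 g \<and> f 0 = 0 \<and> f 1 = 0 \<and>
     (\<exists>f' f''. W21 f f' f'' \<and> (AE x in lebesgue_on {0..1}. g x = - f'' x + V x * f x))}"

text \<open>\<open>H\<^sup>D - \<mu>\<close> is onto and bounded below, that is, bijective with bounded inverse.\<close>

definition dirichlet_resolvent_set :: "(real \<Rightarrow> complex) \<Rightarrow> complex set" where
  "dirichlet_resolvent_set V = {\<mu>.
     (\<forall>g. in_Lp 2 g \<longrightarrow> (\<exists>f. (f, \<lambda>x. \<mu> * f x + g x) \<in> dirichlet_op V)) \<and>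
     (\<exists>C. \<forall>(f, h) \<in> dirichlet_op V.
        sqrt (Lp_mass 2 f) \<le> C * sqrt (Lp_mass 2 (\<lambda>x. h x - \<mu> * f x)))}"

text \<open>A solution of \<open>-\<psi>'' + V\<psi> = \<mu>\<psi>\<close> together with its derivative.\<close>

definition edge_solution ::
  "(real \<Rightarrow> complex) \<Rightarrow> complex \<Rightarrow> (real \<Rightarrow> complex) \<Rightarrow> (real \<Rightarrow> complex) \<Rightarrow> bool" where
  "edge_solution V \<mu> \<psi> \<psi>' \<longleftrightarrow>
     (\<exists>\<psi>''. W21 \<psi> \<psi>' \<psi>'' \<and> (AE x in lebesgue_on {0..1}. - \<psi>'' x + V x * \<psi> x = \<mu> * \<psi> x))"

text \<open>The pair \<open>(\<psi>, \<psi>')\<close> with \<open>\<psi>(0) = a\<close>, \<open>\<psi>'(0) = b\<close>; it exists for integrable \<open>V\<close> and is unique on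
  \<open>[0,1]\<close>, the choice only concerns values outside.\<close>

definition ivp_solution ::
  "(real \<Rightarrow> complex) \<Rightarrow> complex \<Rightarrow> complex \<Rightarrow> complex \<Rightarrow> (real \<Rightarrow> complex) \<times> (real \<Rightarrow> complex)" where
  "ivp_solution V \<mu> a b = (SOME (\<psi>, \<psi>'). edge_solution V \<mu> \<psi> \<psi>' \<and> \<psi> 0 = a \<and> \<psi>' 0 = b)"

definition floquet_discriminant :: "(real \<Rightarrow> complex) \<Rightarrow> complex \<Rightarrow> complex" where
  "floquet_discriminant V \<mu> =
     (let (cs, cs') = ivp_solution V \<mu> 1 0; (sn, sn') = ivp_solution V \<mu> 0 1
      in 1 / 2 * (cs 1 + sn' 1))"


section \<open>Independence of the orientation\<close>

text \<open>
  Expressing an eigenfunction by its vertex values turns the vertex condition at \<open>v\<close> into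
  \<open>c(v) (P z)(v) = (c\<^sub>\<mu>(1) c\<^sub>o\<^sub>u\<^sub>t(v) + s\<^sub>\<mu>'(1) c\<^sub>i\<^sub>n(v)) z(v)\<close>, with the total conductivities \<open>c\<^sub>o\<^sub>u\<^sub>t\<close>, \<open>c\<^sub>i\<^sub>n\<close> of the
  edges starting and ending at \<open>v\<close>. The right-hand side is \<open>c(v) D(\<mu>) z(v)\<close> if \<open>V\<close> is the same on
  every edge irrespective of the direction in which edges are traversed, so that \<open>c\<^sub>\<mu>(1) = s\<^sub>\<mu>'(1)\<close>, or
  if \<open>c\<^sub>o\<^sub>u\<^sub>t = c\<^sub>i\<^sub>n\<close>. In general the correspondence of eigenvalues fails: on a single edge with
  \<open>V(x) = x\<close>, the lowest Neumann eigenvalue satisfies \<open>D(\<mu>) > 1\<close>, whereas \<open>P\<close> has eigenvalues \<open>\<plusminus>1\<close>.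
\<close>

definition symmetric_potential :: "(real \<Rightarrow> complex) \<Rightarrow> bool" where
  "symmetric_potential V \<longleftrightarrow> (AE x in lebesgue_on {0..1}. V (1 - x) = V x)"

definition balanced :: "('v, 'e) pre_digraph \<Rightarrow> ('e \<Rightarrow> real) \<Rightarrow> bool" where
  "balanced G c \<longleftrightarrow> (\<forall>v \<in> verts G.
     (\<Sum>e \<in> {e \<in> arcs G. tail G e = v}. c e) = (\<Sum>e \<in> {e \<in> arcs G. head G e = v}. c e))"

end

theory Submission
  imports Defs
begin

text \<open>
  An eigenfunction of the Schroedinger operator solves \<open>-\<psi>'' + V\<^sub>0\<psi> = \<mu>\<psi>\<close> on every edge. Since \<open>\<mu>\<close> is not
  a Dirichlet eigenvalue, \<open>s\<^sub>\<mu>(1) \<noteq> 0\<close>, and the solution is determined by its two boundary values; by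
  the Wronskian identity \<open>c\<^sub>\<mu>(1) s\<^sub>\<mu>'(1) - c\<^sub>\<mu>'(1) s\<^sub>\<mu>(1) = 1\<close> its outgoing derivatives are
  \<open>(z(v\<^sub>e) - c\<^sub>\<mu>(1) z(v)) / s\<^sub>\<mu>(1)\<close> at \<open>v = i(e)\<close> and \<open>(z(v\<^sub>e) - s\<^sub>\<mu>'(1) z(v)) / s\<^sub>\<mu>(1)\<close> at \<open>v = t(e)\<close>. Hence the
  vertex condition at \<open>v\<close> is \<open>(P z)(v) = D(\<mu>) z(v)\<close>, either because reflecting \<open>s\<^sub>\<mu>\<close> gives
  \<open>c\<^sub>\<mu>(1) = s\<^sub>\<mu>'(1)\<close> for a symmetric potential or because the conductivities are balanced. All norms on
  the two-dimensional solution space are equivalent, so the function lies in \<open>X\<^sub>c\<close> if and only if its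
  vertex values lie in \<open>X\<^sub>d\<close>.
\<close>


section \<open>Linear second-order equations with an integrable coefficient\<close>

text \<open>As \<open>V\<close> is only integrable, \<open>\<psi>'\<close> is merely absolutely
  continuous and the equation holds only almost everywhere. So neither the product rule for the
  Wronskian nor the classical existence theorem is available pointwise; both are deduced from the
  equation in integrated form, with errors measured against the primitive \<open>Q\<close> of
  \<open>norm q\<close>. The second obstacle is uniformity over an infinite graph. Since all edges
  carry the same potential, one basis \<open>\<alpha>\<close>, \<open>\<beta>\<close> and one set of
  constants serve every edge; sums over edges and sums over vertices are then matched by letting
  each edge give its conductivity to both of its end points.\<close>

lemma absolutely_integrable_mult_continuous:
  fixes q f :: "real \<Rightarrow> complex"
  assumes "q absolutely_integrable_on {a..b}" "continuous_on {a..b} f"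
  shows "(\<lambda>t. q t * f t) absolutely_integrable_on {a..b}"
proof -
  have meas: "f \<in> borel_measurable (lebesgue_on {a..b})"
    by (rule continuous_imp_measurable_on_sets_lebesgue[OF assms(2)]) simp
  have bdd: "bounded (f ` {a..b})"
    by (rule compact_imp_bounded[OF compact_continuous_image[OF assms(2) compact_Icc]])
  have bil: "bilinear ((*) :: complex \<Rightarrow> complex \<Rightarrow> complex)"
    by (simp add: bilinear_conv_bounded_bilinear bounded_bilinear_mult)
  have "(\<lambda>t. f t * q t) absolutely_integrable_on {a..b}"
    by (rule absolutely_integrable_bounded_measurable_product[OF bil meas _ bdd assms(1)]) simp
  then show ?thesis by (simp add: mult.commute)
qed

text \<open>A substitute for "zero derivative implies constant" when derivatives exist only almost
  everywhere. Over equal steps shorter than \<delta> the bounds telescope to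
  \<open>\<epsilon> * (R x - R 0)\<close>, and \<epsilon> is arbitrary. The control \<open>R\<close>
  will be a primitive of \<open>1 + norm q\<close> or of \<open>2 * norm q\<close>.\<close>

lemma locally_small_increments_imp_constant:
  fixes H :: "real \<Rightarrow> 'a::real_normed_vector" and R :: "real \<Rightarrow> real"
  assumes small: "\<And>\<epsilon>. \<epsilon> > 0 \<Longrightarrow> \<exists>\<delta>>0. \<forall>x\<in>{0..1}. \<forall>y\<in>{0..1}.
      x \<le> y \<longrightarrow> y - x < \<delta> \<longrightarrow> norm (H y - H x) \<le> \<epsilon> * (R y - R x)"
    and x: "x \<in> {0..1}"
  shows "H x = H 0"
proof -
  have bound: "norm (H x - H 0) \<le> \<epsilon> * (R x - R 0)" if pos: "\<epsilon> > 0" for \<epsilon>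
  proof -
    obtain \<delta> where \<delta>: "\<delta> > 0" and H: "\<forall>s\<in>{0..1}. \<forall>t\<in>{0..1}.
        s \<le> t \<longrightarrow> t - s < \<delta> \<longrightarrow> norm (H t - H s) \<le> \<epsilon> * (R t - R s)"
      using small[OF pos] by blast
    obtain N :: nat where N: "inverse (real (Suc N)) < \<delta>"
      using reals_Archimedean[OF \<delta>] by blast
    define p where "p = (\<lambda>i::nat. x * real i / real (Suc N))"
    have p01: "p i \<in> {0..1}" if "i \<le> Suc N" for i
    proof -
      have "x * real i \<le> 1 * real (Suc N)" using x that by (intro mult_mono) auto
      then show ?thesis using x by (auto simp: p_def divide_simps)
    qed
    have ends: "p 0 = 0" "p (Suc N) = x" by (simp_all add: p_def del: of_nat_Suc)
    have step: "p (Suc i) - p i = x * inverse (real (Suc N))" for i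
      unfolding p_def diff_divide_distrib[symmetric] right_diff_distrib[symmetric]
      by (simp add: divide_inverse)
    have "norm (H x - H 0) = norm (\<Sum>i<Suc N. H (p (Suc i)) - H (p i))"
      by (simp only: sum_lessThan_telescope[of "\<lambda>i. H (p i)"] ends)
    also have "\<dots> \<le> (\<Sum>i<Suc N. \<epsilon> * (R (p (Suc i)) - R (p i)))"
    proof (rule sum_norm_le)
      fix i assume "i \<in> {..<Suc N}"
      then have "p i \<in> {0..1}" "p (Suc i) \<in> {0..1}" using p01 by auto
      moreover have "0 \<le> x * inverse (real (Suc N))" "x * inverse (real (Suc N)) \<le> 1 * inverse (real (Suc N))"
        using x by (intro mult_right_mono mult_nonneg_nonneg; simp)+
      then have "p i \<le> p (Suc i)" "p (Suc i) - p i < \<delta>" using step[of i] N by linarith+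
      ultimately show "norm (H (p (Suc i)) - H (p i)) \<le> \<epsilon> * (R (p (Suc i)) - R (p i))"
        using H by blast
    qed
    also have "\<dots> = \<epsilon> * (R x - R 0)"
      by (simp only: sum_distrib_left[symmetric] sum_lessThan_telescope[of "\<lambda>i. R (p i)"] ends)
    finally show ?thesis .
  qed
  have "norm (H x - H 0) \<le> 0"
  proof (rule ccontr)
    assume neg: "\<not> norm (H x - H 0) \<le> 0"
    \<comment> \<open>Makes \<open>r * (\<bar>R x - R 0\<bar> + 1)\<close> half of the norm; the
      \<open>+ 1\<close> covers the case \<open>R x = R 0\<close>.\<close>
    define r where "r = norm (H x - H 0) / (2 * (\<bar>R x - R 0\<bar> + 1))"
    have "2 * (\<bar>R x - R 0\<bar> + 1) > 0" by (simp add: add_nonneg_pos)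
    then have "r > 0" unfolding r_def using neg by (intro divide_pos_pos) auto
    have "norm (H x - H 0) \<le> r * (R x - R 0)" by (rule bound) fact
    also have "\<dots> \<le> r * (\<bar>R x - R 0\<bar> + 1)" using \<open>r > 0\<close> by (intro mult_left_mono) auto
    also have "\<dots> = norm (H x - H 0) / 2"
      using \<open>2 * (\<bar>R x - R 0\<bar> + 1) > 0\<close> by (simp add: r_def field_simps)
    finally show False using neg by simp
  qed
  then show ?thesis by simp
qed

text \<open>The equation \<open>\<psi>'' = q \<psi>\<close> in integrated form: no second derivative
  has to be named, and changes of \<open>q\<close> on null sets are invisible.\<close>

definition linear_solution ::
  "(real \<Rightarrow> complex) \<Rightarrow> (real \<Rightarrow> complex) \<Rightarrow> (real \<Rightarrow> complex) \<Rightarrow> bool" where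
  "linear_solution q \<psi> \<psi>' \<longleftrightarrow>
     (\<forall>x\<in>{0..1}. (\<psi> has_vector_derivative \<psi>' x) (at x within {0..1})) \<and>
     (\<forall>x\<in>{0..1}. ((\<lambda>t. q t * \<psi> t) has_integral (\<psi>' x - \<psi>' 0)) {0..x})"

lemma linear_solution_continuous: "linear_solution q \<psi> \<psi>' \<Longrightarrow> continuous_on {0..1} \<psi>"
  unfolding linear_solution_def by (rule continuous_on_vector_derivative[of "{0..1}" \<psi> \<psi>']) blast

lemma linear_solution_combine:
  assumes "linear_solution q \<psi> \<psi>'" "linear_solution q \<phi> \<phi>'"
  shows "linear_solution q (\<lambda>x. a * \<psi> x + b * \<phi> x) (\<lambda>x. a * \<psi>' x + b * \<phi>' x)"
proof -
  have "((\<lambda>t. q t * (a * \<psi> t + b * \<phi> t)) has_integral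
      a * \<psi>' x + b * \<phi>' x - (a * \<psi>' 0 + b * \<phi>' 0)) {0..x}" if "x \<in> {0..1}" for x
  proof -
    have "((\<lambda>t. a * (q t * \<psi> t) + b * (q t * \<phi> t)) has_integral
        a * (\<psi>' x - \<psi>' 0) + b * (\<phi>' x - \<phi>' 0)) {0..x}"
      using assms that by (intro has_integral_add has_integral_mult_right) (auto simp: linear_solution_def)
    then show ?thesis by (simp add: algebra_simps)
  qed
  moreover have "((\<lambda>x. a * \<psi> x + b * \<phi> x) has_vector_derivative a * \<psi>' x + b * \<phi>' x) (at x within {0..1})"
    if "x \<in> {0..1}" for x
    using assms that
    by (intro has_vector_derivative_add has_vector_derivative_mult_right) (auto simp: linear_solution_def)
  ultimately show ?thesis unfolding linear_solution_def by blast
qed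

locale integrable_coefficient =
  fixes q :: "real \<Rightarrow> complex"
  assumes integrable: "q absolutely_integrable_on {0..1}"
begin

abbreviation Q :: "real \<Rightarrow> real" where "Q x \<equiv> integral {0..x} (\<lambda>t. norm (q t))"

lemma integrable_on_subinterval:
  assumes "0 \<le> x" "y \<le> 1" "continuous_on {x..y} f"
  shows "(\<lambda>t. q t * f t) absolutely_integrable_on {x..y}"
  using absolutely_integrable_on_subinterval[OF integrable, of x y] assms
  by (intro absolutely_integrable_mult_continuous) auto

lemma norm_integrable: "0 \<le> x \<Longrightarrow> y \<le> 1 \<Longrightarrow> (\<lambda>t. norm (q t)) integrable_on {x..y}"
  using absolutely_integrable_on_subinterval[OF integrable, of x y]
  by (auto simp: absolutely_integrable_on_def)

lemma Q_diff: "0 \<le> x \<Longrightarrow> x \<le> y \<Longrightarrow> y \<le> 1 \<Longrightarrow> integral {x..y} (\<lambda>t. norm (q t)) = Q y - Q x"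
  using Henstock_Kurzweil_Integration.integral_combine[of 0 x y "\<lambda>t. norm (q t)"] norm_integrable[of 0 y]
  by simp

lemma Q_mono: "0 \<le> x \<Longrightarrow> x \<le> y \<Longrightarrow> y \<le> 1 \<Longrightarrow> Q x \<le> Q y"
  using Q_diff[of x y] integral_nonneg[OF norm_integrable[of x y]] by simp

lemma Q_continuous: "continuous_on {0..1} Q"
  by (rule indefinite_integral_continuous_1[OF norm_integrable]) auto

lemma norm_integral_le:
  assumes "0 \<le> x" "x \<le> y" "y \<le> 1" "continuous_on {x..y} f" "\<And>t. t \<in> {x..y} \<Longrightarrow> norm (f t) \<le> B"
  shows "norm (integral {x..y} (\<lambda>t. q t * f t)) \<le> B * (Q y - Q x)"
proof -
  have "norm (integral {x..y} (\<lambda>t. q t * f t)) \<le> integral {x..y} (\<lambda>t. B * norm (q t))"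
    using assms integrable_on_subinterval[of x y f] norm_integrable[of x y]
    by (intro integral_norm_bound_integral integrable_on_mult_right)
       (auto simp: absolutely_integrable_on_def norm_mult mult.commute intro!: mult_right_mono)
  then show ?thesis using Q_diff[of x y] assms by simp
qed

text \<open>The definition integrates from 0 only; the local estimates for the Wronskian need both
  relations on short intervals.\<close>

lemma solution_increment:
  assumes "linear_solution q \<psi> \<psi>'" "0 \<le> x" "x \<le> y" "y \<le> 1"
  shows "((\<lambda>t. q t * \<psi> t) has_integral (\<psi>' y - \<psi>' x)) {x..y}"
    and "(\<psi>' has_integral (\<psi> y - \<psi> x)) {x..y}"
proof -
  have "continuous_on {x..y} \<psi>"
    using linear_solution_continuous[OF assms(1)] assms by (auto intro: continuous_on_subset)
  then have int: "(\<lambda>t. q t * \<psi> t) integrable_on {x..y}"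
    using integrable_on_subinterval[of x y \<psi>] assms by (auto simp: absolutely_integrable_on_def)
  have "continuous_on {0..y} \<psi>"
    using linear_solution_continuous[OF assms(1)] assms by (auto intro: continuous_on_subset)
  then have "(\<lambda>t. q t * \<psi> t) integrable_on {0..y}"
    using integrable_on_subinterval[of 0 y \<psi>] assms by (auto simp: absolutely_integrable_on_def)
  then have split: "integral {0..x} (\<lambda>t. q t * \<psi> t) + integral {x..y} (\<lambda>t. q t * \<psi> t)
      = integral {0..y} (\<lambda>t. q t * \<psi> t)"
    using assms by (intro Henstock_Kurzweil_Integration.integral_combine) auto
  have "integral {0..z} (\<lambda>t. q t * \<psi> t) = \<psi>' z - \<psi>' 0" if "z \<in> {0..1}" for z
    using assms(1) that by (auto simp: linear_solution_def intro: integral_unique)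
  note prim = this
  have "integral {x..y} (\<lambda>t. q t * \<psi> t) = (\<psi>' y - \<psi>' 0) - (\<psi>' x - \<psi>' 0)"
    using prim[of x] prim[of y] assms(2-4)
    by (subst add_diff_cancel_left'[of "integral {0..x} (\<lambda>t. q t * \<psi> t)", symmetric], subst split) simp
  then have "integral {x..y} (\<lambda>t. q t * \<psi> t) = \<psi>' y - \<psi>' x" by simp
  then show "((\<lambda>t. q t * \<psi> t) has_integral (\<psi>' y - \<psi>' x)) {x..y}"
    using int by (metis has_integral_integral)
  show "(\<psi>' has_integral (\<psi> y - \<psi> x)) {x..y}"
  proof (rule fundamental_theorem_of_calculus[OF assms(3)])
    fix z assume "z \<in> {x..y}"
    then have "(\<psi> has_vector_derivative \<psi>' z) (at z within {0..1})" "{x..y} \<subseteq> {0..1}"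
      using assms by (auto simp: linear_solution_def)
    then show "(\<psi> has_vector_derivative \<psi>' z) (at z within {x..y})"
      by (rule has_vector_derivative_within_subset)
  qed
qed

lemma solution_derivative_continuous:
  assumes "linear_solution q \<psi> \<psi>'"
  shows "continuous_on {0..1} \<psi>'"
proof -
  have "(\<lambda>t. q t * \<psi> t) integrable_on {0..1}"
    using integrable_on_subinterval[of 0 1 \<psi>] linear_solution_continuous[OF assms]
    by (simp add: absolutely_integrable_on_def)
  then have "continuous_on {0..1} (\<lambda>x. \<psi>' 0 + integral {0..x} (\<lambda>t. q t * \<psi> t))"
    by (intro continuous_on_add continuous_on_const indefinite_integral_continuous_1)
  then show ?thesis
  proof (rule continuous_on_eq)
    fix x :: real assume "x \<in> {0..1}"
    then have "integral {0..x} (\<lambda>t. q t * \<psi> t) = \<psi>' x - \<psi>' 0"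
      using assms by (intro integral_unique) (auto simp: linear_solution_def)
    then show "\<psi>' 0 + integral {0..x} (\<lambda>t. q t * \<psi> t) = \<psi>' x" by simp
  qed
qed

text \<open>The increment of the Wronskian over \<open>[x,y]\<close> is the integral of
  \<open>\<psi>'(t) \<phi>'(y) - \<psi>'(y) \<phi>'(t) + q(t) (\<psi>(x) \<phi>(t) - \<psi>(t) \<phi>(x))\<close>, which is small relative to
  \<open>\<integral> (1 + |q|)\<close> by uniform continuity; this replaces the product rule for absolutely continuous functions.\<close>

lemma wronskian_constant:
  assumes \<psi>: "linear_solution q \<psi> \<psi>'" and \<phi>: "linear_solution q \<phi> \<phi>'" and x: "x \<in> {0..1}"
  shows "\<psi> x * \<phi>' x - \<psi>' x * \<phi> x = \<psi> 0 * \<phi>' 0 - \<psi>' 0 * \<phi> 0"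
proof (rule locally_small_increments_imp_constant
    [where H = "\<lambda>x. \<psi> x * \<phi>' x - \<psi>' x * \<phi> x" and R = "\<lambda>x. x + Q x", OF _ x])
  fix \<epsilon> :: real assume "\<epsilon> > 0"
  note cont = linear_solution_continuous[OF \<psi>] linear_solution_continuous[OF \<phi>]
    solution_derivative_continuous[OF \<psi>] solution_derivative_continuous[OF \<phi>]
  have bound: "\<exists>M. \<forall>x\<in>{0..1}. norm (f x) \<le> M" if "continuous_on {0..1} f" for f :: "real \<Rightarrow> complex"
    using compact_imp_bounded[OF compact_continuous_image[OF that compact_Icc]]
    by (auto simp: bounded_iff)
  obtain M1 where "\<forall>x\<in>{0..1}. norm (\<psi> x) \<le> M1" using bound[OF cont(1)] by blast
  moreover obtain M2 where "\<forall>x\<in>{0..1}. norm (\<phi> x) \<le> M2" using bound[OF cont(2)] by blast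
  moreover obtain M3 where "\<forall>x\<in>{0..1}. norm (\<psi>' x) \<le> M3" using bound[OF cont(3)] by blast
  moreover obtain M4 where "\<forall>x\<in>{0..1}. norm (\<phi>' x) \<le> M4" using bound[OF cont(4)] by blast
  moreover define M where "M = 1 + \<bar>M1\<bar> + \<bar>M2\<bar> + \<bar>M3\<bar> + \<bar>M4\<bar>"
  ultimately have M: "M > 0" "\<forall>x\<in>{0..1}. norm (\<psi> x) \<le> M" "\<forall>x\<in>{0..1}. norm (\<phi> x) \<le> M"
    "\<forall>x\<in>{0..1}. norm (\<psi>' x) \<le> M" "\<forall>x\<in>{0..1}. norm (\<phi>' x) \<le> M"
    by (auto elim!: ballE dest!: bspec intro: order_trans)
  \<comment> \<open>A difference of two products splits into two terms, each at most
    \<open>\<eta> * M\<close>; see \<open>small2\<close>.\<close>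
  define \<eta> where "\<eta> = \<epsilon> / (2 * M)"
  have "\<eta> > 0" using \<open>\<epsilon> > 0\<close> M(1) by (simp add: \<eta>_def)
  have close: "\<exists>\<delta>>0. \<forall>x\<in>{0..1}. \<forall>y\<in>{0..1}. dist y x < \<delta> \<longrightarrow> norm (f y - f x) \<le> \<eta>"
    if "continuous_on {0..1} f" for f :: "real \<Rightarrow> complex"
    using compact_uniformly_continuous[OF that compact_Icc] \<open>\<eta> > 0\<close>
    unfolding uniformly_continuous_on_def dist_norm by (meson less_imp_le)
  obtain d1 where d1: "d1 > 0" "\<forall>x\<in>{0..1}. \<forall>y\<in>{0..1}. dist y x < d1 \<longrightarrow> norm (\<psi> y - \<psi> x) \<le> \<eta>"
    using close[OF cont(1)] by blast
  obtain d2 where d2: "d2 > 0" "\<forall>x\<in>{0..1}. \<forall>y\<in>{0..1}. dist y x < d2 \<longrightarrow> norm (\<phi> y - \<phi> x) \<le> \<eta>"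
    using close[OF cont(2)] by blast
  obtain d3 where d3: "d3 > 0" "\<forall>x\<in>{0..1}. \<forall>y\<in>{0..1}. dist y x < d3 \<longrightarrow> norm (\<psi>' y - \<psi>' x) \<le> \<eta>"
    using close[OF cont(3)] by blast
  obtain d4 where d4: "d4 > 0" "\<forall>x\<in>{0..1}. \<forall>y\<in>{0..1}. dist y x < d4 \<longrightarrow> norm (\<phi>' y - \<phi>' x) \<le> \<eta>"
    using close[OF cont(4)] by blast
  note d = d1(1) d2(1) d3(1) d4(1) d1(2) d2(2) d3(2) d4(2)
  define \<delta> where "\<delta> = min (min d1 d2) (min d3 d4)"
  have small2: "norm (u * v - w * z) \<le> \<epsilon>"
    if "norm (u - w) \<le> \<eta>" "norm (z - v) \<le> \<eta>" "norm v \<le> M" "norm w \<le> M" for u v w z :: complex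
  proof -
    have "u * v - w * z = (u - w) * v - w * (z - v)" by (simp add: algebra_simps)
    also have "norm \<dots> \<le> norm (u - w) * norm v + norm w * norm (z - v)"
      by (metis norm_mult norm_triangle_ineq4)
    also have "\<dots> \<le> \<eta> * M + M * \<eta>" using that M(1) \<open>\<eta> > 0\<close> by (intro add_mono mult_mono) auto
    also have "\<dots> = \<epsilon>" using M(1) by (simp add: \<eta>_def)
    finally show ?thesis .
  qed
  have "norm ((\<psi> y * \<phi>' y - \<psi>' y * \<phi> y) - (\<psi> x * \<phi>' x - \<psi>' x * \<phi> x)) \<le> \<epsilon> * ((y + Q y) - (x + Q x))"
    if x: "x \<in> {0..1}" and y: "y \<in> {0..1}" and xy: "x \<le> y" "y - x < \<delta>" for x y
  proof -
    have near: "norm (\<psi>' t - \<psi>' y) \<le> \<eta>" "norm (\<phi>' t - \<phi>' y) \<le> \<eta>"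
      "norm (\<psi> x - \<psi> t) \<le> \<eta>" "norm (\<phi> x - \<phi> t) \<le> \<eta>" "t \<in> {0..1}"
      if "t \<in> {x..y}" for t
    proof -
      have t: "t \<in> {0..1}" "dist t y < \<delta>" "dist x t < \<delta>" using that x y xy by (auto simp: dist_real_def)
      show "t \<in> {0..1}" by fact
      show "norm (\<psi>' t - \<psi>' y) \<le> \<eta>" "norm (\<phi>' t - \<phi>' y) \<le> \<eta>"
        "norm (\<psi> x - \<psi> t) \<le> \<eta>" "norm (\<phi> x - \<phi> t) \<le> \<eta>"
        using t x y d(5-8) by (simp_all add: \<delta>_def)
    qed
    have sub: "{x..y} \<subseteq> {0..1}" using x y by auto
    note inc = solution_increment[OF \<psi>, of x y] solution_increment[OF \<phi>, of x y]
    \<comment> \<open>Discrete product rule: \<open>\<psi> y * \<phi>' y - \<psi> x * \<phi>' x =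
      (\<psi> y - \<psi> x) * \<phi>' y + \<psi> x * (\<phi>' y - \<phi>' x)\<close>, and similarly
      for the other product. \<open>1\<close> collects the increments of \<psi> and \<phi>, whose
      integrands are free of \<open>q\<close>; \<open>2\<close> collects those of the derivatives,
      which carry the factor \<open>q\<close>.\<close>
    have 1: "((\<lambda>t. \<psi>' t * \<phi>' y - \<psi>' y * \<phi>' t) has_integral (\<psi> y - \<psi> x) * \<phi>' y - \<psi>' y * (\<phi> y - \<phi> x)) {x..y}"
      by (rule has_integral_diff[OF has_integral_mult_left[OF inc(2)] has_integral_mult_right[OF inc(4)]])
        (use x y xy in auto)
    have "((\<lambda>t. \<psi> x * (q t * \<phi> t) - (q t * \<psi> t) * \<phi> x) has_integral
        \<psi> x * (\<phi>' y - \<phi>' x) - (\<psi>' y - \<psi>' x) * \<phi> x) {x..y}"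
      by (rule has_integral_diff[OF has_integral_mult_right[OF inc(3)] has_integral_mult_left[OF inc(1)]])
        (use x y xy in auto)
    then have 2: "((\<lambda>t. q t * (\<psi> x * \<phi> t - \<psi> t * \<phi> x)) has_integral
        \<psi> x * (\<phi>' y - \<phi>' x) - (\<psi>' y - \<psi>' x) * \<phi> x) {x..y}"
      by (simp add: algebra_simps)
    have n1: "norm ((\<psi> y - \<psi> x) * \<phi>' y - \<psi>' y * (\<phi> y - \<phi> x)) \<le> \<epsilon> * (y - x)"
    proof -
      have "norm (\<psi>' t * \<phi>' y - \<psi>' y * \<phi>' t) \<le> \<epsilon>" if "t \<in> {x..y} - {}" for t
        using small2[of "\<psi>' t" "\<psi>' y" "\<phi>' t" "\<phi>' y"] near[of t] that bspec[OF M(4) y] bspec[OF M(5) y]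
        by fastforce
      from has_integral_bound_real[OF less_imp_le[OF \<open>\<epsilon> > 0\<close>] finite.emptyI 1 this]
      show ?thesis using xy(1) by (simp only: measure_lborel_Icc)
    qed
    have n2: "norm (\<psi> x * (\<phi>' y - \<phi>' x) - (\<psi>' y - \<psi>' x) * \<phi> x) \<le> \<epsilon> * (Q y - Q x)"
    proof -
      have "norm (\<psi> x * \<phi> t - \<psi> t * \<phi> x) \<le> \<epsilon>" if "t \<in> {x..y}" for t
        using small2[of "\<psi> x" "\<psi> t" "\<phi> x" "\<phi> t"] near[of t] that bspec[OF M(2), of t] bspec[OF M(3), of t]
        by (fastforce simp: norm_minus_commute)
      moreover have "continuous_on {x..y} (\<lambda>t. \<psi> x * \<phi> t - \<psi> t * \<phi> x)"
        by (intro continuous_intros continuous_on_subset[OF cont(1) sub] continuous_on_subset[OF cont(2) sub])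
      ultimately have "norm (integral {x..y} (\<lambda>t. q t * (\<psi> x * \<phi> t - \<psi> t * \<phi> x))) \<le> \<epsilon> * (Q y - Q x)"
        using x y xy by (intro norm_integral_le) auto
      then show ?thesis using 2 by (simp add: integral_unique)
    qed
    have "(\<psi> y * \<phi>' y - \<psi>' y * \<phi> y) - (\<psi> x * \<phi>' x - \<psi>' x * \<phi> x)
       = ((\<psi> y - \<psi> x) * \<phi>' y - \<psi>' y * (\<phi> y - \<phi> x)) + (\<psi> x * (\<phi>' y - \<phi>' x) - (\<psi>' y - \<psi>' x) * \<phi> x)"
      by (simp add: algebra_simps)
    also have "norm \<dots> \<le> \<epsilon> * (y - x) + \<epsilon> * (Q y - Q x)"
      using n1 n2 by (rule norm_triangle_mono)
    finally show ?thesis by (simp add: algebra_simps)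
  qed
  moreover have "\<delta> > 0" using d by (simp add: \<delta>_def)
  ultimately show "\<exists>\<delta>>0. \<forall>x\<in>{0..1}. \<forall>y\<in>{0..1}. x \<le> y \<longrightarrow> y - x < \<delta> \<longrightarrow>
      norm ((\<psi> y * \<phi>' y - \<psi>' y * \<phi> y) - (\<psi> x * \<phi>' x - \<psi>' x * \<phi> x)) \<le> \<epsilon> * ((y + Q y) - (x + Q x))"
    by blast
qed

text \<open>In the supremum norm weighted by \<open>1 / weight\<close> the Volterra operator below has norm at most \<open>1/2\<close> on
  the whole of \<open>[0,1]\<close>, so no subdivision of the interval is needed.\<close>

definition weight :: "real \<Rightarrow> real" where "weight x = exp (2 * Q x)"

lemma weight_pos: "weight x > 0" by (simp add: weight_def)

lemma weight_mono: "0 \<le> x \<Longrightarrow> x \<le> y \<Longrightarrow> y \<le> 1 \<Longrightarrow> weight x \<le> weight y"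
  using Q_mono by (simp add: weight_def)

lemma weight_continuous: "continuous_on {0..1} weight"
  unfolding weight_def by (intro continuous_intros Q_continuous)

lemma norm_q_mult_integrable:
  assumes "0 \<le> x" "y \<le> 1"
  shows "(\<lambda>t. norm (q t) * weight t) integrable_on {x..y}"
proof -
  have "continuous_on {x..y} (\<lambda>t. complex_of_real (weight t))"
    using assms by (intro continuous_intros continuous_on_subset[OF weight_continuous]) auto
  then have "(\<lambda>t. norm (q t * complex_of_real (weight t))) integrable_on {x..y}"
    using integrable_on_subinterval[OF assms] by (simp add: absolutely_integrable_on_def)
  then show ?thesis using weight_pos by (simp add: norm_mult less_imp_le)
qed

text \<open>Both are \<open>exp t \<ge> 1 + t\<close>, at \<open>t = b - a\<close> and
  \<open>t = a - b\<close>: the secant slope of a convex function lies between the slopes at the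
  ends.\<close>

lemma exp_diff_bounds:
  fixes a b :: real
  shows "exp a * (b - a) \<le> exp b - exp a" "exp b - exp a \<le> exp b * (b - a)"
proof -
  have "exp a * (1 + (b - a)) \<le> exp a * exp (b - a)" by (intro mult_left_mono exp_ge_add_one_self) auto
  then show "exp a * (b - a) \<le> exp b - exp a" by (simp add: algebra_simps mult_exp_exp)
  have "exp b * (1 + (a - b)) \<le> exp b * exp (a - b)" by (intro mult_left_mono exp_ge_add_one_self) auto
  then show "exp b - exp a \<le> exp b * (b - a)" by (simp add: algebra_simps mult_exp_exp)
qed

text \<open>Formally \<open>weight' = 2 * norm q * weight\<close>, so the integral is
  \<open>(weight x - weight 0) / 2\<close>; the factor 2 in the exponent is the source of the
  contraction constant 1/2. Since \<open>Q\<close> need not be differentiable everywhere, the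
  identity is obtained from small increments.\<close>

lemma weight_integral:
  assumes x: "x \<in> {0..1}"
  shows "integral {0..x} (\<lambda>t. norm (q t) * weight t) \<le> weight x / 2"
proof -
  let ?J = "\<lambda>x. integral {0..x} (\<lambda>t. norm (q t) * weight t)"
  have "weight x - 2 * ?J x = weight 0 - 2 * ?J 0"
  proof (rule locally_small_increments_imp_constant[where H = "\<lambda>x. weight x - 2 * ?J x" and R = "\<lambda>x. 2 * Q x", OF _ x])
    fix \<epsilon> :: real assume "\<epsilon> > 0"
    then obtain \<delta> where \<delta>: "\<delta> > 0" "\<And>x y. \<lbrakk>x \<in> {0..1}; y \<in> {0..1}; dist y x < \<delta>\<rbrakk> \<Longrightarrow> dist (weight y) (weight x) < \<epsilon>"
      using compact_uniformly_continuous[OF weight_continuous compact_Icc]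
      unfolding uniformly_continuous_on_def by meson
    have "norm ((weight y - 2 * ?J y) - (weight x - 2 * ?J x)) \<le> \<epsilon> * (2 * Q y - 2 * Q x)"
      if x: "x \<in> {0..1}" and y: "y \<in> {0..1}" and xy: "x \<le> y" "y - x < \<delta>" for x y
    proof -
      have J: "?J y - ?J x = integral {x..y} (\<lambda>t. norm (q t) * weight t)"
        using Henstock_Kurzweil_Integration.integral_combine[of 0 x y "\<lambda>t. norm (q t) * weight t"]
          norm_q_mult_integrable[of 0 y] x y xy by simp
      have Qd: "integral {x..y} (\<lambda>t. norm (q t)) = Q y - Q x" using Q_diff[of x y] x y xy by simp
      have ints: "(\<lambda>t. norm (q t) * weight t) integrable_on {x..y}" "(\<lambda>t. norm (q t) * k) integrable_on {x..y}" for k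
        using x y by (simp_all add: norm_q_mult_integrable integrable_on_mult_left norm_integrable)
      have "integral {x..y} (\<lambda>t. norm (q t) * weight t) \<le> integral {x..y} (\<lambda>t. norm (q t) * weight y)"
        by (rule integral_le[OF ints]) (use x y weight_mono in \<open>auto intro!: mult_left_mono\<close>)
      moreover have "integral {x..y} (\<lambda>t. norm (q t) * weight x) \<le> integral {x..y} (\<lambda>t. norm (q t) * weight t)"
        by (rule integral_le[OF ints(2,1)]) (use x y weight_mono in \<open>auto intro!: mult_left_mono\<close>)
      ultimately have up: "?J y - ?J x \<le> (Q y - Q x) * weight y" and lo: "(Q y - Q x) * weight x \<le> ?J y - ?J x"
        using J Qd by simp_all
      have "weight x * (2 * Q y - 2 * Q x) \<le> weight y - weight x" "weight y - weight x \<le> weight y * (2 * Q y - 2 * Q x)"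
        unfolding weight_def by (rule exp_diff_bounds)+
      moreover have "weight x * (2 * Q y - 2 * Q x) = 2 * ((Q y - Q x) * weight x)"
        "weight y * (2 * Q y - 2 * Q x) = 2 * ((Q y - Q x) * weight y)"
        by (simp_all add: algebra_simps)
      \<comment> \<open>The increments of \<open>weight\<close> and of \<open>2 * ?J\<close> both
        lie between \<open>2 * (Q y - Q x)\<close> times \<open>weight x\<close> and times
        \<open>weight y\<close>, so they differ by at most the length of that interval.\<close>
      ultimately have "\<bar>(weight y - 2 * ?J y) - (weight x - 2 * ?J x)\<bar> \<le>
          2 * ((Q y - Q x) * weight y) - 2 * ((Q y - Q x) * weight x)"
        using up lo by linarith
      also have "\<dots> = (weight y - weight x) * (2 * Q y - 2 * Q x)" by (simp add: algebra_simps)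
      also have "\<dots> \<le> \<epsilon> * (2 * Q y - 2 * Q x)"
        using \<delta>(2)[OF x y] xy Q_mono[of x y] x y by (intro mult_right_mono) (auto simp: dist_real_def)
      finally show ?thesis by simp
    qed
    with \<delta>(1) show "\<exists>\<delta>>0. \<forall>x\<in>{0..1}. \<forall>y\<in>{0..1}. x \<le> y \<longrightarrow> y - x < \<delta> \<longrightarrow>
        norm ((weight y - 2 * ?J y) - (weight x - 2 * ?J x)) \<le> \<epsilon> * (2 * Q y - 2 * Q x)"
      by blast
  qed
  then show ?thesis using weight_pos[of 0] by simp
qed

section \<open>The Volterra integral equation: uniqueness and existence of solutions\<close>

definition volterra :: "(real \<Rightarrow> complex) \<Rightarrow> real \<Rightarrow> complex" where
  "volterra h x = integral {0..x} (\<lambda>s. integral {0..s} (\<lambda>t. q t * h t))"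

lemma inner_integral_continuous:
  assumes "continuous_on {0..1} h"
  shows "continuous_on {0..1} (\<lambda>s. integral {0..s} (\<lambda>t. q t * h t))"
  using integrable_on_subinterval[of 0 1 h] assms
  by (intro indefinite_integral_continuous_1) (auto simp: absolutely_integrable_on_def)

lemma volterra_derivative:
  assumes "continuous_on {0..1} h" "x \<in> {0..1}"
  shows "(volterra h has_vector_derivative integral {0..x} (\<lambda>t. q t * h t)) (at x within {0..1})"
  unfolding volterra_def
  using integral_has_vector_derivative[OF inner_integral_continuous[OF assms(1)] assms(2)] .

lemma volterra_continuous: "continuous_on {0..1} h \<Longrightarrow> continuous_on {0..1} (volterra h)"
  by (rule continuous_on_vector_derivative[OF volterra_derivative])

lemma volterra_diff:
  assumes "continuous_on {0..1} g" "continuous_on {0..1} h" "x \<in> {0..1}"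
  shows "volterra g x - volterra h x = volterra (\<lambda>t. g t - h t) x"
proof -
  have int: "(\<lambda>t. q t * f t) integrable_on {0..s}"
    if "continuous_on {0..1} f" "s \<in> {0..x}" for f :: "real \<Rightarrow> complex" and s
    using integrable_on_subinterval[of 0 s f] continuous_on_subset[OF that(1), of "{0..s}"] that(2) assms(3)
    by (auto simp: absolutely_integrable_on_def)
  have "volterra (\<lambda>t. g t - h t) x =
      integral {0..x} (\<lambda>s. integral {0..s} (\<lambda>t. q t * g t) - integral {0..s} (\<lambda>t. q t * h t))"
    unfolding volterra_def
    by (rule integral_cong) (simp add: right_diff_distrib Henstock_Kurzweil_Integration.integral_diff int assms)
  also have "\<dots> = volterra g x - volterra h x"
    unfolding volterra_def using assms(3)
    by (intro Henstock_Kurzweil_Integration.integral_diff integrable_continuous_real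
        continuous_on_subset[OF inner_integral_continuous[OF assms(1)]]
        continuous_on_subset[OF inner_integral_continuous[OF assms(2)]]) auto
  finally show ?thesis by simp
qed

text \<open>The inner integral gains the factor 1/2 by \<open>weight_integral\<close>, and
  monotonicity allows \<open>weight x\<close> in place of \<open>weight s\<close>; the outer
  integral runs over an interval of length at most 1 and costs nothing.\<close>

lemma volterra_bound:
  assumes h: "continuous_on {0..1} h" and bound: "\<And>t. t \<in> {0..1} \<Longrightarrow> norm (h t) \<le> S * weight t"
    and x: "x \<in> {0..1}"
  shows "norm (volterra h x) \<le> S * weight x / 2"
proof -
  have "0 \<le> S * weight 0" using order_trans[OF norm_ge_zero bound[of 0]] by simp
  then have "S \<ge> 0" using weight_pos[of 0] by (simp add: zero_le_mult_iff)
  have inner: "norm (integral {0..s} (\<lambda>t. q t * h t)) \<le> S * weight x / 2" if s: "s \<in> {0..x}" for s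
  proof -
    have "norm (integral {0..s} (\<lambda>t. q t * h t)) \<le> integral {0..s} (\<lambda>t. S * (norm (q t) * weight t))"
    proof (rule integral_norm_bound_integral)
      show "(\<lambda>t. q t * h t) integrable_on {0..s}"
        using integrable_on_subinterval[of 0 s h] continuous_on_subset[OF h, of "{0..s}"] s x
        by (auto simp: absolutely_integrable_on_def)
      show "(\<lambda>t. S * (norm (q t) * weight t)) integrable_on {0..s}"
        using s x by (intro integrable_on_mult_right norm_q_mult_integrable) auto
      fix t assume "t \<in> {0..s}"
      then have "norm (q t) * norm (h t) \<le> norm (q t) * (S * weight t)"
        using s x by (intro mult_left_mono bound) auto
      then show "norm (q t * h t) \<le> S * (norm (q t) * weight t)" by (simp add: norm_mult algebra_simps)
    qed
    also have "\<dots> = S * integral {0..s} (\<lambda>t. norm (q t) * weight t)" by simp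
    also have "\<dots> \<le> S * (weight x / 2)"
      using weight_integral[of s] weight_mono[of s x] s x \<open>S \<ge> 0\<close> by (intro mult_left_mono) auto
    finally show ?thesis by simp
  qed
  have "norm (volterra h x) \<le> S * weight x / 2 * (x - 0)"
    unfolding volterra_def using inner x inner_integral_continuous[OF h]
    by (intro integral_bound) (auto intro: continuous_on_subset)
  also have "\<dots> \<le> S * weight x / 2 * 1"
    using x \<open>S \<ge> 0\<close> weight_pos[of x] by (intro mult_left_mono) auto
  finally show ?thesis by simp
qed

text \<open>Together with \<open>volterra_solution\<close> this makes the initial value problem a
  fixed point equation, whose affine part carries the initial data.\<close>

lemma solution_volterra:
  assumes \<psi>: "linear_solution q \<psi> \<psi>'" and x: "x \<in> {0..1}"
  shows "\<psi> x = \<psi> 0 + \<psi>' 0 * of_real x + volterra \<psi> x"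
proof -
  note c = linear_solution_continuous[OF \<psi>]
  have "(\<psi>' has_integral (\<psi> x - \<psi> 0)) {0..x}" using solution_increment(2)[OF \<psi>, of 0 x] x by auto
  moreover have const: "((\<lambda>s. \<psi>' 0) has_integral (x - 0) *\<^sub>R \<psi>' 0) {0..x}"
    using has_integral_const_real[of "\<psi>' 0" 0 x] x by simp
  have "((\<lambda>s. \<psi>' 0 + integral {0..s} (\<lambda>t. q t * \<psi> t)) has_integral
      (x - 0) *\<^sub>R \<psi>' 0 + volterra \<psi> x) {0..x}"
    unfolding volterra_def using x inner_integral_continuous[OF c]
    by (intro has_integral_add[OF const] integrable_integral integrable_continuous_real)
      (auto intro: continuous_on_subset)
  moreover have "\<psi>' 0 + integral {0..s} (\<lambda>t. q t * \<psi> t) = \<psi>' s" if "s \<in> {0..x}" for s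
  proof -
    have "integral {0..s} (\<lambda>t. q t * \<psi> t) = \<psi>' s - \<psi>' 0"
      using \<psi> that x by (intro integral_unique) (auto simp: linear_solution_def)
    then show ?thesis by simp
  qed
  ultimately have "\<psi> x - \<psi> 0 = (x - 0) *\<^sub>R \<psi>' 0 + volterra \<psi> x"
    using has_integral_eq has_integral_unique by (metis (no_types, lifting))
  then show ?thesis by (simp add: scaleR_conv_of_real algebra_simps)
qed

lemma volterra_solution:
  assumes h: "continuous_on {0..1} \<psi>"
    and eq: "\<And>x. x \<in> {0..1} \<Longrightarrow> \<psi> x = a + b * of_real x + volterra \<psi> x"
  shows "linear_solution q \<psi> (\<lambda>x. b + integral {0..x} (\<lambda>t. q t * \<psi> t))"
  unfolding linear_solution_def
proof (intro conjI ballI)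
  fix x :: real assume x: "x \<in> {0..1}"
  have "((\<lambda>x. a + b * of_real x + volterra \<psi> x) has_vector_derivative
      b + integral {0..x} (\<lambda>t. q t * \<psi> t)) (at x within {0..1})"
    by (auto intro!: derivative_eq_intros volterra_derivative[OF h x] has_vector_derivative_of_real)
  then show "(\<psi> has_vector_derivative b + integral {0..x} (\<lambda>t. q t * \<psi> t)) (at x within {0..1})"
    by (rule has_vector_derivative_transform[OF x, rotated]) (simp add: eq)
  have "(\<lambda>t. q t * \<psi> t) integrable_on {0..x}"
    using integrable_on_subinterval[of 0 x \<psi>] continuous_on_subset[OF h, of "{0..x}"] x
    by (auto simp: absolutely_integrable_on_def)
  then show "((\<lambda>t. q t * \<psi> t) has_integral
      b + integral {0..x} (\<lambda>t. q t * \<psi> t) - (b + integral {0..0} (\<lambda>t. q t * \<psi> t))) {0..x}"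
    by (simp add: integrable_integral)
qed

text \<open>Let \<open>S\<close> be the maximum of \<open>norm \<psi> / weight\<close>. With zero
  initial data \<psi> equals its own Volterra image, so the bound at the maximum point gives
  \<open>S \<le> S / 2\<close>.\<close>

lemma solution_zero:
  assumes \<psi>: "linear_solution q \<psi> \<psi>'" and "\<psi> 0 = 0" "\<psi>' 0 = 0" and x: "x \<in> {0..1}"
  shows "\<psi> x = 0"
proof -
  note c = linear_solution_continuous[OF \<psi>]
  have "continuous_on {0..1} (\<lambda>x. norm (\<psi> x) / weight x)"
    using weight_pos by (intro continuous_intros c weight_continuous) (metis less_irrefl)
  then obtain z where z: "z \<in> {0..1}" "\<And>t. t \<in> {0..1} \<Longrightarrow> norm (\<psi> t) / weight t \<le> norm (\<psi> z) / weight z"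
    using continuous_attains_sup[OF compact_Icc, of 0 1 "\<lambda>x. norm (\<psi> x) / weight x"] by auto
  define S where "S = norm (\<psi> z) / weight z"
  have bound: "norm (\<psi> t) \<le> S * weight t" if "t \<in> {0..1}" for t
    using z(2)[OF that] weight_pos[of t] by (simp add: S_def[symmetric] pos_divide_le_eq)
  have "norm (\<psi> z) \<le> S * weight z / 2"
    using volterra_bound[OF c bound z(1)] solution_volterra[OF \<psi> z(1)] assms by simp
  then have "norm (\<psi> z) \<le> norm (\<psi> z) / 2" using weight_pos[of z] by (simp add: S_def)
  then have "S = 0" by (simp add: S_def)
  then show ?thesis using bound[OF x] by simp
qed

lemma solution_exists:
  obtains \<psi> \<psi>' where "linear_solution q \<psi> \<psi>'" "\<psi> 0 = a" "\<psi>' 0 = b"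
proof -
  \<comment> \<open>Composing with this retraction onto [0,1] turns a function continuous there into
    a bounded continuous function on the line, an element of a complete space in which Banach's
    fixed point theorem applies.\<close>
  define clip where "clip = (\<lambda>x::real. max 0 (min 1 x))"
  have clip: "clip x \<in> {0..1}" "x \<in> {0..1} \<Longrightarrow> clip x = x" for x by (auto simp: clip_def)
  have clip_cont: "continuous_on UNIV clip" unfolding clip_def by (intro continuous_intros)
  \<comment> \<open>An element of that space stands for \<open>\<psi> / weight\<close>, so that the
    plain supremum distance is the weighted one in which the Volterra operator contracts.\<close>
  define lift where "lift = (\<lambda>\<phi> :: real \<Rightarrow>\<^sub>C complex. \<lambda>t. of_real (weight t) * \<phi> t)"
  have lift_cont: "continuous_on {0..1} (lift \<phi>)" for \<phi>
    unfolding lift_def by (intro continuous_intros weight_continuous) auto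
  define F where "F = (\<lambda>\<phi> x. (a + b * of_real x + volterra (lift \<phi>) x) / of_real (weight x))"
  have F_cont: "continuous_on {0..1} (F \<phi>)" for \<phi>
    unfolding F_def using weight_pos
    by (intro continuous_intros volterra_continuous lift_cont weight_continuous) (metis less_irrefl of_real_eq_0_iff)
  have "F \<phi> \<circ> clip \<in> bcontfun" for \<phi>
  proof -
    have "continuous_on UNIV (F \<phi> \<circ> clip)"
      using clip by (intro continuous_on_compose clip_cont continuous_on_subset[OF F_cont]) auto
    moreover have "bounded (F \<phi> ` {0..1})"
      by (intro compact_imp_bounded compact_continuous_image F_cont) auto
    then have "bounded (range (F \<phi> \<circ> clip))" by (rule bounded_subset) (use clip in auto)
    ultimately show ?thesis by (simp add: bcontfun_def)
  qed
  then have T: "apply_bcontfun (Bcontfun (F \<phi> \<circ> clip)) = F \<phi> \<circ> clip" for \<phi>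
    by (rule Bcontfun_inverse)
  have "dist (Bcontfun (F \<phi> \<circ> clip)) (Bcontfun (F \<rho> \<circ> clip)) \<le> 1 / 2 * dist \<phi> \<rho>" for \<phi> \<rho>
  proof (rule dist_bound, unfold T, unfold comp_def)
    fix x :: real
    define y where "y = clip x"
    have y: "y \<in> {0..1}" using clip by (simp add: y_def)
    have "norm (volterra (\<lambda>t. lift \<phi> t - lift \<rho> t) y) \<le> dist \<phi> \<rho> * weight y / 2"
    proof (rule volterra_bound[OF _ _ y])
      show "continuous_on {0..1} (\<lambda>t. lift \<phi> t - lift \<rho> t)" by (intro continuous_intros lift_cont)
      fix t
      have "norm (lift \<phi> t - lift \<rho> t) = weight t * dist (\<phi> t) (\<rho> t)"
        using weight_pos[of t] by (simp add: lift_def right_diff_distrib[symmetric] norm_mult dist_norm)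
      also have "\<dots> \<le> weight t * dist \<phi> \<rho>" using weight_pos[of t] by (intro mult_left_mono dist_bounded) auto
      finally show "norm (lift \<phi> t - lift \<rho> t) \<le> dist \<phi> \<rho> * weight t" by (simp add: mult.commute)
    qed
    moreover have "F \<phi> y - F \<rho> y = volterra (\<lambda>t. lift \<phi> t - lift \<rho> t) y / of_real (weight y)"
      by (simp add: F_def volterra_diff[OF lift_cont lift_cont y, symmetric] diff_divide_distrib[symmetric])
    ultimately show "dist (F \<phi> (clip x)) (F \<rho> (clip x)) \<le> 1 / 2 * dist \<phi> \<rho>"
      using weight_pos[of y] by (simp add: dist_norm y_def[symmetric] norm_divide pos_divide_le_eq)
  qed
  then obtain \<phi> where \<phi>: "Bcontfun (F \<phi> \<circ> clip) = \<phi>"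
    using banach_fix_type[of "1/2" "\<lambda>\<phi>. Bcontfun (F \<phi> \<circ> clip)"] by auto
  have fixed: "lift \<phi> x = a + b * of_real x + volterra (lift \<phi>) x" if "x \<in> {0..1}" for x
  proof -
    have "\<phi> x = F \<phi> x" using T[of \<phi>] clip(2)[OF that] unfolding \<phi> by (metis comp_apply)
    then show ?thesis using weight_pos[of x] by (simp add: F_def lift_def)
  qed
  note sol = volterra_solution[OF lift_cont fixed]
  have "lift \<phi> 0 = a" using fixed[of 0] by (simp add: volterra_def)
  then show ?thesis using that[OF sol] by simp
qed

end


section \<open>Boundary values of solutions on an edge\<close>

context integrable_coefficient begin

lemma solution_derivative_zero:
  assumes \<psi>: "linear_solution q \<psi> \<psi>'" and "\<psi> 0 = 0" "\<psi>' 0 = 0" and x: "x \<in> {0..1}"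
  shows "\<psi>' x = 0"
proof -
  have "((\<lambda>t. q t * \<psi> t) has_integral (\<psi>' x - \<psi>' 0)) {0..x}"
    using \<psi> x by (simp add: linear_solution_def)
  moreover have "((\<lambda>t. q t * \<psi> t) has_integral 0) {0..x}"
    by (rule has_integral_is_0) (use solution_zero[OF assms(1-3)] x in auto)
  ultimately have "\<psi>' x - \<psi>' 0 = 0" by (rule has_integral_unique)
  then show ?thesis using assms(3) by simp
qed

lemma solution_determined:
  assumes "linear_solution q \<psi> \<psi>'" "linear_solution q \<phi> \<phi>'"
    and "\<psi> 0 = \<phi> 0" "\<psi>' 0 = \<phi>' 0" and x: "x \<in> {0..1}"
  shows "\<psi> x = \<phi> x" "\<psi>' x = \<phi>' x"
  using solution_zero[OF linear_solution_combine[OF assms(1,2), of 1 "-1"] _ _ x]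
    solution_derivative_zero[OF linear_solution_combine[OF assms(1,2), of 1 "-1"] _ _ x] assms(3,4)
  by simp_all

text \<open>Substituting \<open>1 - x\<close> reverses the sign of the first derivative and keeps
  that of the second. The integrated equation does not see the null set on which the symmetry of
  \<open>q\<close> may fail.\<close>

lemma solution_reflect:
  assumes \<psi>: "linear_solution q \<psi> \<psi>'" and sym: "negligible {x \<in> {0..1}. q (1 - x) \<noteq> q x}"
  shows "linear_solution q (\<lambda>x. \<psi> (1 - x)) (\<lambda>x. - \<psi>' (1 - x))"
  unfolding linear_solution_def
proof (intro conjI ballI)
  fix x :: real assume x: "x \<in> {0..1}"
  have "((\<psi> \<circ> (\<lambda>x. 1 - x)) has_vector_derivative (-1) *\<^sub>R \<psi>' (1 - x)) (at x within {0..1})"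
  proof (rule vector_diff_chain_within)
    show "((\<lambda>x. 1 - x) has_vector_derivative -1) (at x within {0..1})"
      by (auto intro!: derivative_eq_intros)
    have img: "(\<lambda>x::real. 1 - x) ` {0..1} = {0..1}" by (simp add: image_diff_atLeastAtMost)
    show "(\<psi> has_vector_derivative \<psi>' (1 - x)) (at (1 - x) within (\<lambda>x. 1 - x) ` {0..1})"
      unfolding img using \<psi> x by (auto simp: linear_solution_def)
  qed
  then show "((\<lambda>x. \<psi> (1 - x)) has_vector_derivative - \<psi>' (1 - x)) (at x within {0..1})"
    by (simp add: comp_def)
  have "((\<lambda>t. q t * \<psi> t) has_integral (\<psi>' 1 - \<psi>' (1 - x))) (cbox (1 - x) 1)"
    using solution_increment(1)[OF \<psi>, of "1 - x" 1] x by simp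
  from has_integral_affinity[OF this, of "-1" 1]
  have "((\<lambda>t. q (1 - t) * \<psi> (1 - t)) has_integral (\<psi>' 1 - \<psi>' (1 - x))) ((\<lambda>x. 1 - x) ` {1 - x..1})"
    by simp
  then have "((\<lambda>t. q (1 - t) * \<psi> (1 - t)) has_integral (\<psi>' 1 - \<psi>' (1 - x))) {0..x}"
    by (simp add: image_diff_atLeastAtMost)
  then have "((\<lambda>t. q t * \<psi> (1 - t)) has_integral (\<psi>' 1 - \<psi>' (1 - x))) {0..x}"
    by (rule has_integral_spike[OF sym, rotated]) (use x in simp)
  then show "((\<lambda>t. q t * \<psi> (1 - t)) has_integral - \<psi>' (1 - x) - - \<psi>' (1 - 0)) {0..x}"
    by simp
qed

end

section \<open>Edge solutions, the Dirichlet operator and the boundary basis\<close>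

lemma AE_lebesgue_on_iff_negligible:
  "(AE x in lebesgue_on {a..b::real}. P x) \<longleftrightarrow> negligible {x \<in> {a..b}. \<not> P x}"
proof -
  have "(AE x in lebesgue_on {a..b}. P x) \<longleftrightarrow> (AE x in lebesgue. x \<in> {a..b} \<longrightarrow> P x)"
    by (rule AE_restrict_space_iff) simp
  also have "\<dots> \<longleftrightarrow> (\<exists>N. negligible N \<and> {x \<in> {a..b}. \<not> P x} \<subseteq> N)"
    unfolding eventually_ae_filter by (auto simp: negligible_iff_null_sets)
  also have "\<dots> \<longleftrightarrow> negligible {x \<in> {a..b}. \<not> P x}"
    by (meson negligible_subset subset_refl)
  finally show ?thesis .
qed

text \<open>Forwards, \<open>\<psi>''\<close> agrees with \<open>(V - \<mu>) \<psi>\<close> off a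
  null set, which integrals ignore; backwards, this product itself serves as the weak second
  derivative.\<close>

lemma edge_solution_iff_linear_solution:
  assumes V: "V absolutely_integrable_on {0..1}"
  shows "edge_solution V \<mu> \<psi> \<psi>' \<longleftrightarrow> linear_solution (\<lambda>x. V x - \<mu>) \<psi> \<psi>'"
proof
  assume "edge_solution V \<mu> \<psi> \<psi>'"
  then obtain \<psi>'' where W: "W21 \<psi> \<psi>' \<psi>''"
    and ae: "negligible {x \<in> {0..1}. \<not> (- \<psi>'' x + V x * \<psi> x = \<mu> * \<psi> x)}"
    unfolding edge_solution_def AE_lebesgue_on_iff_negligible by blast
  have "((\<lambda>t. (V t - \<mu>) * \<psi> t) has_integral (\<psi>' x - \<psi>' 0)) {0..x}" if "x \<in> {0..1}" for x
  proof (rule has_integral_spike[OF ae])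
    show "(\<psi>'' has_integral \<psi>' x - \<psi>' 0) {0..x}" using W that by (simp add: W21_def)
    fix t assume "t \<in> {0..x} - {x \<in> {0..1}. \<not> (- \<psi>'' x + V x * \<psi> x = \<mu> * \<psi> x)}"
    then have "- \<psi>'' t + V t * \<psi> t = \<mu> * \<psi> t" using that by auto
    then show "(V t - \<mu>) * \<psi> t = \<psi>'' t" by (simp add: algebra_simps)
  qed
  with W show "linear_solution (\<lambda>x. V x - \<mu>) \<psi> \<psi>'"
    by (simp add: linear_solution_def W21_def)
next
  assume sol: "linear_solution (\<lambda>x. V x - \<mu>) \<psi> \<psi>'"
  have "(\<lambda>x. V x - \<mu>) absolutely_integrable_on {0..1}"
    by (intro set_integral_diff V) simp
  then have "(\<lambda>x. (V x - \<mu>) * \<psi> x) absolutely_integrable_on {0..1}"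
    using linear_solution_continuous[OF sol] by (rule absolutely_integrable_mult_continuous)
  with sol have "W21 \<psi> \<psi>' (\<lambda>x. (V x - \<mu>) * \<psi> x)"
    by (simp add: linear_solution_def W21_def)
  then show "edge_solution V \<mu> \<psi> \<psi>'"
    unfolding edge_solution_def by (intro exI conjI) (auto simp: algebra_simps)
qed

lemma continuous_in_Lp:
  assumes f: "continuous_on {0..1} f" and p: "p > 0"
  shows "in_Lp p f" "Lp_mass p f = integral {0..1} (\<lambda>x. norm (f x) powr p)"
proof -
  have c: "continuous_on {0..1} (\<lambda>x. norm (f x) powr p)"
    using p by (intro continuous_on_powr' continuous_intros f) auto
  have int: "integrable (lebesgue_on {0..1}) (\<lambda>x. norm (f x) powr p)"
    by (rule continuous_imp_integrable_real[OF c])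
  then show "in_Lp p f"
    using continuous_imp_measurable_on_sets_lebesgue[OF f] by (simp add: in_Lp_def)
  show "Lp_mass p f = integral {0..1} (\<lambda>x. norm (f x) powr p)"
    unfolding Lp_mass_def by (rule lebesgue_integral_eq_integral[OF int]) simp
qed

text \<open>Such a \<psi> lies in the kernel of \<open>H\<^sup>D - \<mu>\<close>. The lower bound
  contained in the resolvent set makes its mass 0, and continuity turns this into vanishing at every
  point.\<close>

lemma dirichlet_solution_zero:
  assumes V: "V absolutely_integrable_on {0..1}" and \<mu>: "\<mu> \<in> dirichlet_resolvent_set V"
    and sol: "linear_solution (\<lambda>x. V x - \<mu>) \<psi> \<psi>'" and "\<psi> 0 = 0" "\<psi> 1 = 0" and x: "x \<in> {0..1}"
  shows "\<psi> x = 0"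
proof -
  note c = linear_solution_continuous[OF sol]
  have "edge_solution V \<mu> \<psi> \<psi>'" using sol edge_solution_iff_linear_solution[OF V] by blast
  then obtain \<psi>'' where "W21 \<psi> \<psi>' \<psi>''" "AE x in lebesgue_on {0..1}. - \<psi>'' x + V x * \<psi> x = \<mu> * \<psi> x"
    unfolding edge_solution_def by blast
  moreover have "in_Lp 2 \<psi>" "in_Lp 2 (\<lambda>x. \<mu> * \<psi> x)"
    by (intro continuous_in_Lp continuous_intros c; simp)+
  ultimately have "(\<psi>, \<lambda>x. \<mu> * \<psi> x) \<in> dirichlet_op V"
    using assms(4,5) unfolding dirichlet_op_def by (auto elim!: eventually_mono intro!: exI)
  then obtain C where "sqrt (Lp_mass 2 \<psi>) \<le> C * sqrt (Lp_mass 2 (\<lambda>x. \<mu> * \<psi> x - \<mu> * \<psi> x))"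
    using \<mu> unfolding dirichlet_resolvent_set_def by fast
  then have "Lp_mass 2 \<psi> \<le> 0" by (simp add: Lp_mass_def)
  moreover have Lp: "Lp_mass 2 \<psi> = integral {0..1} (\<lambda>x. norm (\<psi> x) powr 2)"
    by (rule continuous_in_Lp(2)[OF c]) simp
  moreover have "0 \<le> Lp_mass 2 \<psi>" unfolding Lp_mass_def by (rule integral_nonneg_AE) simp
  ultimately have "integral {0..1} (\<lambda>x. norm (\<psi> x) powr 2) = 0" by simp
  moreover have "continuous_on {0..1} (\<lambda>x. norm (\<psi> x) powr 2)"
    by (intro continuous_on_powr' continuous_intros c) auto
  ultimately show ?thesis using integral_eq_0_iff[of 0 1 "\<lambda>x. norm (\<psi> x) powr 2"] x by auto
qed

lemma ivp_solution:
  assumes V: "V absolutely_integrable_on {0..1}"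
  obtains \<psi> \<psi>' where "ivp_solution V \<mu> a b = (\<psi>, \<psi>')" "linear_solution (\<lambda>x. V x - \<mu>) \<psi> \<psi>'"
    "\<psi> 0 = a" "\<psi>' 0 = b"
proof -
  interpret integrable_coefficient "\<lambda>x. V x - \<mu>"
    by unfold_locales (intro set_integral_diff V, simp)
  obtain \<phi> \<phi>' where "linear_solution (\<lambda>x. V x - \<mu>) \<phi> \<phi>'" "\<phi> 0 = a" "\<phi>' 0 = b"
    by (rule solution_exists)
  then have "(\<lambda>(\<psi>, \<psi>'). edge_solution V \<mu> \<psi> \<psi>' \<and> \<psi> 0 = a \<and> \<psi>' 0 = b) (\<phi>, \<phi>')"
    by (simp add: edge_solution_iff_linear_solution[OF V])
  then have "case ivp_solution V \<mu> a b of (\<psi>, \<psi>') \<Rightarrow> edge_solution V \<mu> \<psi> \<psi>' \<and> \<psi> 0 = a \<and> \<psi>' 0 = b"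
    unfolding ivp_solution_def by (rule someI)
  then show ?thesis
    using that by (cases "ivp_solution V \<mu> a b") (auto simp: edge_solution_iff_linear_solution[OF V])
qed

text \<open>\<open>\<alpha>\<close> and \<open>\<beta>\<close> are the solutions with boundary values \<open>(1,0)\<close> and \<open>(0,1)\<close>; \<open>C\<close>, \<open>S\<close> and \<open>s\<close> stand for
  \<open>c\<^sub>\<mu>(1)\<close>, \<open>s\<^sub>\<mu>'(1)\<close> and \<open>s\<^sub>\<mu>(1)\<close>.\<close>

locale boundary_basis = integrable_coefficient q for q +
  fixes \<alpha> \<alpha>' \<beta> \<beta>' :: "real \<Rightarrow> complex" and C S s :: complex
  assumes \<alpha>: "linear_solution q \<alpha> \<alpha>'" "\<alpha> 0 = 1" "\<alpha> 1 = 0" "\<alpha>' 0 = - C / s" "\<alpha>' 1 = - 1 / s"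
    and \<beta>: "linear_solution q \<beta> \<beta>'" "\<beta> 0 = 0" "\<beta> 1 = 1" "\<beta>' 0 = 1 / s" "\<beta>' 1 = S / s"
    and s_nonzero: "s \<noteq> 0"

lemma boundary_basis_exists:
  assumes V: "V absolutely_integrable_on {0..1}" and \<mu>: "\<mu> \<in> dirichlet_resolvent_set V"
  obtains \<alpha> \<alpha>' \<beta> \<beta>' C S s where "boundary_basis (\<lambda>x. V x - \<mu>) \<alpha> \<alpha>' \<beta> \<beta>' C S s"
    "floquet_discriminant V \<mu> = (C + S) / 2" "symmetric_potential V \<longrightarrow> C = S"
proof -
  interpret integrable_coefficient "\<lambda>x. V x - \<mu>"
    by unfold_locales (intro set_integral_diff V, simp)
  obtain cs cs' where cs: "ivp_solution V \<mu> 1 0 = (cs, cs')" "linear_solution (\<lambda>x. V x - \<mu>) cs cs'"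
    "cs 0 = 1" "cs' 0 = 0" by (rule ivp_solution[OF V])
  obtain sn sn' where sn: "ivp_solution V \<mu> 0 1 = (sn, sn')" "linear_solution (\<lambda>x. V x - \<mu>) sn sn'"
    "sn 0 = 0" "sn' 0 = 1" by (rule ivp_solution[OF V])
  have nz: "sn 1 \<noteq> 0"
  proof
    \<comment> \<open>Then \<open>sn\<close> satisfies both Dirichlet conditions and vanishes on
      [0,1], which its initial slope 1 forbids.\<close>
    assume "sn 1 = 0"
    then have zero: "sn x = 0" if "x \<in> {0..1}" for x
      using dirichlet_solution_zero[OF V \<mu> sn(2,3) _ that] by simp
    have "(sn has_vector_derivative 0) (at 0 within {0..1})"
      by (rule has_vector_derivative_transform[of _ _ _ "\<lambda>_. 0"]) (use zero in auto)
    moreover have "(sn has_vector_derivative sn' 0) (at 0 within {0..1})"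
      using sn(2) by (simp add: linear_solution_def)
    ultimately have "sn' 0 = 0"
      using vector_derivative_unique_within[of "0::real" "{0..1}"] by (auto simp: trivial_limit_within islimpt_Icc)
    then show False using sn by simp
  qed
  have wr: "cs 1 * sn' 1 - cs' 1 * sn 1 = 1"
    using wronskian_constant[OF cs(2) sn(2), of 1] cs sn by simp
  \<comment> \<open>These are \<open>cs - (cs 1 / sn 1) sn\<close> and \<open>sn / sn 1\<close>,
    with the trivial coefficients written out to fit \<open>linear_solution_combine\<close>. The
    Wronskian identity \<open>wr\<close> reduces the slope of the first one at 1 to
    \<open>- 1 / sn 1\<close>.\<close>
  let ?\<alpha> = "\<lambda>x. 1 * cs x + (- cs 1 / sn 1) * sn x" and ?\<alpha>' = "\<lambda>x. 1 * cs' x + (- cs 1 / sn 1) * sn' x"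
  let ?\<beta> = "\<lambda>x. 0 * cs x + (1 / sn 1) * sn x" and ?\<beta>' = "\<lambda>x. 0 * cs' x + (1 / sn 1) * sn' x"
  have "boundary_basis (\<lambda>x. V x - \<mu>) ?\<alpha> ?\<alpha>' ?\<beta> ?\<beta>' (cs 1) (sn' 1) (sn 1)"
    using cs sn nz wr
    by unfold_locales (rule linear_solution_combine[OF cs(2) sn(2)] | simp add: field_simps)+
  moreover have "floquet_discriminant V \<mu> = (cs 1 + sn' 1) / 2"
    by (simp add: floquet_discriminant_def cs sn)
  moreover have "cs 1 = sn' 1" if "symmetric_potential V"
  proof -
    have "negligible {x \<in> {0..1}. V (1 - x) - \<mu> \<noteq> V x - \<mu>}"
      using that by (simp add: symmetric_potential_def AE_lebesgue_on_iff_negligible)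
    note refl = solution_reflect[OF sn(2) this]
    \<comment> \<open>The reflected \<open>sn\<close> starts with value \<open>sn 1\<close> and
      slope \<open>- sn' 1\<close>, so it is \<open>sn 1 * cs - sn' 1 * sn\<close>; at 1 it takes
      the value \<open>sn 0 = 0\<close>.\<close>
    have "sn (1 - 1) = sn 1 * cs 1 + - sn' 1 * sn 1"
      by (rule solution_determined(1)[OF refl linear_solution_combine[OF cs(2) sn(2)]])
        (use cs sn in simp_all)
    then show ?thesis using nz sn by (simp add: algebra_simps)
  qed
  ultimately show ?thesis by (intro that) auto
qed

context boundary_basis begin

lemma combination: "linear_solution q (\<lambda>x. a * \<alpha> x + b * \<beta> x) (\<lambda>x. a * \<alpha>' x + b * \<beta>' x)"
  by (rule linear_solution_combine[OF \<alpha>(1) \<beta>(1)])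

lemma solution_boundary_values:
  assumes \<psi>: "linear_solution q \<psi> \<psi>'" and x: "x \<in> {0..1}"
  shows "\<psi> x = \<psi> 0 * \<alpha> x + \<psi> 1 * \<beta> x" "\<psi>' x = \<psi> 0 * \<alpha>' x + \<psi> 1 * \<beta>' x"
proof -
  \<comment> \<open>The coefficient of \<beta> forced by the initial slope:
    \<open>\<psi>' 0 = (b - C * \<psi> 0) / s\<close>. Evaluation at 1 then identifies it as
    \<open>\<psi> 1\<close>.\<close>
  define b where "b = C * \<psi> 0 + s * \<psi>' 0"
  have init: "\<psi> 0 = \<psi> 0 * \<alpha> 0 + b * \<beta> 0" "\<psi>' 0 = \<psi> 0 * \<alpha>' 0 + b * \<beta>' 0"
    using s_nonzero by (simp_all add: \<alpha>(2,4) \<beta>(2,4) b_def add_divide_distrib)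
  have *: "\<psi> y = \<psi> 0 * \<alpha> y + b * \<beta> y \<and> \<psi>' y = \<psi> 0 * \<alpha>' y + b * \<beta>' y" if "y \<in> {0..1}" for y
    using solution_determined[OF \<psi> combination init that] by blast
  have "\<psi> 1 = \<psi> 0 * \<alpha> 1 + b * \<beta> 1" using *[of 1] by simp
  then have "\<psi> 1 = b" by (simp add: \<alpha>(3) \<beta>(3))
  with *[OF x] show "\<psi> x = \<psi> 0 * \<alpha> x + \<psi> 1 * \<beta> x" "\<psi>' x = \<psi> 0 * \<alpha>' x + \<psi> 1 * \<beta>' x" by simp_all
qed

text \<open>\<open>M\<close> dominates the four basis functions and derivatives and does not depend
  on the coefficients, so it is a common constant for all edges; the second estimate is the mean
  value inequality.\<close>

lemma basis_bounds:
  obtains M where "M \<ge> 1"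
    "\<And>a b x. x \<in> {0..1} \<Longrightarrow> norm (a * \<alpha> x + b * \<beta> x) \<le> M * (norm a + norm b)"
    "\<And>a b x y. x \<in> {0..1} \<Longrightarrow> y \<in> {0..1} \<Longrightarrow>
      norm ((a * \<alpha> x + b * \<beta> x) - (a * \<alpha> y + b * \<beta> y)) \<le> M * (norm a + norm b) * \<bar>x - y\<bar>"
proof -
  have bound: "\<exists>M. \<forall>x\<in>{0..1}. norm (f x) \<le> M" if "continuous_on {0..1} f" for f :: "real \<Rightarrow> complex"
    using compact_imp_bounded[OF compact_continuous_image[OF that compact_Icc]]
    by (auto simp: bounded_iff)
  obtain M1 where 1: "\<forall>x\<in>{0..1}. norm (\<alpha> x) \<le> M1" using bound[OF linear_solution_continuous[OF \<alpha>(1)]] by blast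
  obtain M2 where 2: "\<forall>x\<in>{0..1}. norm (\<beta> x) \<le> M2" using bound[OF linear_solution_continuous[OF \<beta>(1)]] by blast
  obtain M3 where 3: "\<forall>x\<in>{0..1}. norm (\<alpha>' x) \<le> M3" using bound[OF solution_derivative_continuous[OF \<alpha>(1)]] by blast
  obtain M4 where 4: "\<forall>x\<in>{0..1}. norm (\<beta>' x) \<le> M4" using bound[OF solution_derivative_continuous[OF \<beta>(1)]] by blast
  define M where "M = 1 + \<bar>M1\<bar> + \<bar>M2\<bar> + \<bar>M3\<bar> + \<bar>M4\<bar>"
  have M: "norm (\<alpha> x) \<le> M" "norm (\<beta> x) \<le> M" "norm (\<alpha>' x) \<le> M" "norm (\<beta>' x) \<le> M" if "x \<in> {0..1}" for x
    using bspec[OF 1 that] bspec[OF 2 that] bspec[OF 3 that] bspec[OF 4 that] by (simp_all add: M_def)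
  have sum: "norm (a * u + b * v) \<le> M * (norm a + norm b)" if "norm u \<le> M" "norm v \<le> M" for a b u v :: complex
  proof -
    have "norm (a * u + b * v) \<le> norm a * norm u + norm b * norm v"
      by (metis norm_mult norm_triangle_ineq)
    also have "\<dots> \<le> norm a * M + norm b * M" using that by (intro add_mono mult_left_mono) auto
    finally show ?thesis by (simp add: algebra_simps)
  qed
  show ?thesis
  proof (rule that)
    show "M \<ge> 1" by (simp add: M_def)
    show "norm (a * \<alpha> x + b * \<beta> x) \<le> M * (norm a + norm b)" if "x \<in> {0..1}" for a b x
      by (rule sum) (use M[OF that] in auto)
    show "norm ((a * \<alpha> x + b * \<beta> x) - (a * \<alpha> y + b * \<beta> y)) \<le> M * (norm a + norm b) * \<bar>x - y\<bar>"
      if "x \<in> {0..1}" "y \<in> {0..1}" for a b x y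
    proof -
      have "norm ((a * \<alpha> x + b * \<beta> x) - (a * \<alpha> y + b * \<beta> y)) \<le> M * (norm a + norm b) * norm (x - y)"
      proof (rule differentiable_bound[of "{0..1}" _ "\<lambda>t h. h *\<^sub>R (a * \<alpha>' t + b * \<beta>' t)"])
        fix t :: real assume t: "t \<in> {0..1}"
        show "((\<lambda>x. a * \<alpha> x + b * \<beta> x) has_derivative (\<lambda>h. h *\<^sub>R (a * \<alpha>' t + b * \<beta>' t))) (at t within {0..1})"
          using combination t by (simp add: linear_solution_def has_vector_derivative_def)
        show "onorm (\<lambda>h. h *\<^sub>R (a * \<alpha>' t + b * \<beta>' t)) \<le> M * (norm a + norm b)"
          using sum[OF M(3,4)[OF t], of a b] by (intro onorm_le) (simp add: mult.commute mult_left_mono)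
      qed (use that in auto)
      then show ?thesis by simp
    qed
  qed
qed

section \<open>Equivalence of norms on the solution space\<close>

lemma combination_continuous: "continuous_on {0..1} (\<lambda>x. a * \<alpha> x + b * \<beta> x)"
  by (rule linear_solution_continuous[OF combination])

lemma Lp_mass_upper:
  assumes p: "1 \<le> p"
  obtains K where "K \<ge> 0"
    "\<And>a b. Lp_mass p (\<lambda>x. a * \<alpha> x + b * \<beta> x) \<le> K * (norm a powr p + norm b powr p)"
proof -
  obtain M where M: "M \<ge> 1"
    "\<And>a b x. x \<in> {0..1} \<Longrightarrow> norm (a * \<alpha> x + b * \<beta> x) \<le> M * (norm a + norm b)"
    using basis_bounds by metis
  have "Lp_mass p (\<lambda>x. a * \<alpha> x + b * \<beta> x) \<le> (2 * M) powr p * (norm a powr p + norm b powr p)" for a b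
  proof -
    \<comment> \<open>\<open>norm a + norm b \<le> 2 * ?m\<close>, while \<open>?m powr p\<close> is
      one of the two summands on the right; hence the constant
      \<open>(2 * M) powr p\<close>.\<close>
    let ?m = "max (norm a) (norm b)"
    have c: "continuous_on {0..1} (\<lambda>x. norm (a * \<alpha> x + b * \<beta> x) powr p)"
      using p by (intro continuous_on_powr' continuous_on_norm combination_continuous continuous_on_const) auto
    have "Lp_mass p (\<lambda>x. a * \<alpha> x + b * \<beta> x) = integral {0..1} (\<lambda>x. norm (a * \<alpha> x + b * \<beta> x) powr p)"
      using p by (intro continuous_in_Lp combination_continuous) auto
    also have "\<dots> \<le> integral {0..1} (\<lambda>x::real. (2 * M * ?m) powr p)"
    proof (rule integral_le)
      show "norm (a * \<alpha> x + b * \<beta> x) powr p \<le> (2 * M * ?m) powr p" if "x \<in> {0..1}" for x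
      proof (rule powr_mono2)
        have "M * (norm a + norm b) \<le> M * (2 * ?m)" using M(1) by (intro mult_left_mono) auto
        then show "norm (a * \<alpha> x + b * \<beta> x) \<le> 2 * M * ?m" using M(2)[OF that, of a b] by simp
      qed (use p in auto)
    qed (auto intro!: integrable_continuous_real c)
    also have "\<dots> = (2 * M) powr p * ?m powr p" using M(1) by (simp add: powr_mult)
    also have "\<dots> \<le> (2 * M) powr p * (norm a powr p + norm b powr p)"
      by (intro mult_left_mono) (auto simp: max_def)
    finally show ?thesis .
  qed
  then show ?thesis by (intro that[of "(2 * M) powr p"]) auto
qed

text \<open>Compactness of the unit sphere and homogeneity: all norms on the two-dimensional solution space are equivalent.\<close>

lemma Lp_mass_lower:
  assumes p: "1 \<le> p"
  obtains m where "m > 0"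
    "\<And>a b. m * (norm a powr p + norm b powr p) \<le> Lp_mass p (\<lambda>x. a * \<alpha> x + b * \<beta> x)"
proof -
  define N where "N = (\<lambda>z::complex \<times> complex. integral (cbox 0 1) (\<lambda>x. norm (fst z * \<alpha> x + snd z * \<beta> x) powr p))"
  have mass: "Lp_mass p (\<lambda>x. a * \<alpha> x + b * \<beta> x) = N (a, b)" for a b
    unfolding N_def using p by (simp add: continuous_in_Lp[OF combination_continuous])
  have cont: "continuous_on (sphere 0 1) N"
    unfolding N_def
  proof (rule integral_continuous_on_param)
    have snd: "continuous_on (sphere 0 1 \<times> cbox 0 1) (\<lambda>w. f (snd w))"
      if "continuous_on {0..1} f" for f :: "real \<Rightarrow> complex"
      by (rule continuous_on_compose2[OF that]) (auto intro!: continuous_intros)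
    show "continuous_on (sphere (0 :: complex \<times> complex) 1 \<times> cbox 0 1)
        (\<lambda>(z, x). norm (fst z * \<alpha> x + snd z * \<beta> x) powr p)"
      unfolding case_prod_beta using p
      by (intro continuous_on_powr' continuous_intros snd linear_solution_continuous[OF \<alpha>(1)]
          linear_solution_continuous[OF \<beta>(1)]) auto
  qed
  have "norm (1 :: complex, 0 :: complex) = 1" by (simp add: norm_Pair)
  then have "sphere (0 :: complex \<times> complex) 1 \<noteq> {}" by (metis empty_iff mem_sphere_0)
  then obtain z0 where z0: "norm z0 = 1" and min: "\<And>z. norm z = 1 \<Longrightarrow> N z0 \<le> N z"
    using continuous_attains_inf[OF compact_sphere _ cont] by auto
  have "N z0 > 0"
  proof (rule ccontr)
    let ?f = "\<lambda>x. norm (fst z0 * \<alpha> x + snd z0 * \<beta> x) powr p"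
    assume "\<not> N z0 > 0"
    moreover have "N z0 \<ge> 0" unfolding N_def by (rule integral_nonneg[OF integrable_continuous])
        (use p in \<open>auto intro!: continuous_on_powr' continuous_on_norm combination_continuous\<close>)
    ultimately have "integral {0..1} ?f = 0" by (simp add: N_def)
    moreover have "continuous_on {0..1} ?f"
      using p by (intro continuous_on_powr' continuous_on_norm combination_continuous continuous_on_const) auto
    ultimately have "\<forall>x\<in>{0..1}. ?f x = 0" using integral_eq_0_iff[of 0 1 ?f] by auto
    \<comment> \<open>The values at 0 and 1 are the coefficients themselves, so a combination
      vanishing on [0,1] is trivial.\<close>
    from bspec[OF this, of 0] bspec[OF this, of 1] have "fst z0 = 0" "snd z0 = 0"
      using \<alpha>(2,3) \<beta>(2,3) by auto
    then have "z0 = 0" by (simp add: prod_eq_iff)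
    then show False using z0 by simp
  qed
  \<comment> \<open>With \<open>r = norm (a, b)\<close>, both \<open>norm a\<close> and
    \<open>norm b\<close> are at most \<open>r\<close>, so their powers add up to at most
    \<open>2 * r powr p\<close>; hence the division by 2.\<close>
  have lower: "N z0 / 2 * (norm a powr p + norm b powr p) \<le> N (a, b)" for a b
  proof (cases "(a, b) = 0")
    case True
    then have "a = 0" "b = 0" by (simp_all add: zero_prod_def)
    then show ?thesis using p by (simp add: N_def)
  next
    case False
    define r where "r = norm (a, b)"
    have r: "r > 0" using False by (simp add: r_def)
    have "N (a, b) = r powr p * N ((1 / r) *\<^sub>R (a, b))"
    proof -
      have "norm (a * \<alpha> x + b * \<beta> x) = r * norm (a / of_real r * \<alpha> x + b / of_real r * \<beta> x)" for x
      proof -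
        have "a * \<alpha> x + b * \<beta> x = of_real r * (a / of_real r * \<alpha> x + b / of_real r * \<beta> x)"
          using r by (simp add: field_simps)
        then show ?thesis using r by (metis norm_mult norm_of_real abs_of_pos)
      qed
      then have "norm (a * \<alpha> x + b * \<beta> x) powr p =
          r powr p * norm (a / of_real r * \<alpha> x + b / of_real r * \<beta> x) powr p" for x
        using r by (simp add: powr_mult)
      then show ?thesis by (simp add: N_def scaleR_conv_of_real divide_inverse mult.commute)
    qed
    moreover have "N z0 \<le> N ((1 / r) *\<^sub>R (a, b))" using r by (intro min) (simp add: r_def del: scaleR_Pair)
    ultimately have "r powr p * N z0 \<le> N (a, b)" by (simp add: mult_left_mono)
    moreover have "norm a powr p \<le> r powr p" "norm b powr p \<le> r powr p"
      using p norm_fst_le[of a b] norm_snd_le[of b a] unfolding r_def by (auto intro!: powr_mono2)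
    then have "N z0 / 2 * (norm a powr p + norm b powr p) \<le> N z0 / 2 * (r powr p + r powr p)"
      using \<open>N z0 > 0\<close> by (intro mult_left_mono) auto
    ultimately show ?thesis by (simp add: mult.commute)
  qed
  show ?thesis by (rule that[of "N z0 / 2"]) (use \<open>N z0 > 0\<close> lower mass in auto)
qed

end


section \<open>The path metric\<close>

text \<open>A condition on single edges, verifiable in the edge coordinate;
  \<open>edge_lipschitz_dist\<close> makes it a Lipschitz bound for the path metric, because paths
  consist of segments inside edges.\<close>

definition edge_lipschitz ::
  "('v, 'e) pre_digraph \<Rightarrow> real \<Rightarrow> (('v, 'e) gpoint \<Rightarrow> 'a::real_normed_vector) \<Rightarrow> bool" where
  "edge_lipschitz G L f \<longleftrightarrow> (\<forall>e\<in>arcs G. \<forall>x\<in>{0..1}. \<forall>y\<in>{0..1}.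
     norm (f (edge_point G e x) - f (edge_point G e y)) \<le> L * \<bar>x - y\<bar>)"

text \<open>The distance to the vertex \<open>v\<close>, truncated at 1; its sublevel set at level 1 is the open star of \<open>v\<close>.\<close>

definition vertex_gauge :: "('v, 'e) pre_digraph \<Rightarrow> 'v \<Rightarrow> ('v, 'e) gpoint \<Rightarrow> real" where
  "vertex_gauge G v p = (case p of
     Vertex w \<Rightarrow> if w = v then 0 else 1
   | Inner e x \<Rightarrow> if tail G e = v then x else if head G e = v then 1 - x else 1)"

text \<open>The distance to the complement of the open edge \<open>e\<close>. It tells in which open
  edge a point lies, which vertex gauges cannot do for parallel edges.\<close>

definition edge_gauge :: "'e \<Rightarrow> ('v, 'e) gpoint \<Rightarrow> real" where
  "edge_gauge e p = (case p of Vertex w \<Rightarrow> 0 | Inner e' x \<Rightarrow> if e' = e then min x (1 - x) else 0)"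

lemma Vertex_in_points [simp]: "Vertex v \<in> points G \<longleftrightarrow> v \<in> verts G"
  by (auto simp: points_def)

lemma Inner_in_points [simp]: "Inner e x \<in> points G \<longleftrightarrow> e \<in> arcs G \<and> 0 < x \<and> x < 1"
  by (auto simp: points_def)

lemma edge_point_simps [simp]:
  "edge_point G e 0 = Vertex (tail G e)" "edge_point G e 1 = Vertex (head G e)"
  "0 < x \<Longrightarrow> x < 1 \<Longrightarrow> edge_point G e x = Inner e x"
  by (auto simp: edge_point_def)

lemma path_length_nonneg: "path_length G p q l \<Longrightarrow> 0 \<le> l"
  by (induction rule: path_length.induct) auto

text \<open>Segments are appended at the end of a path, so the induction runs over the second path,
  which is why it comes first among the assumptions.\<close>

lemma path_length_trans:
  assumes "path_length G q r m" "path_length G p q l"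
  shows "path_length G p r (l + m)"
  using assms
proof (induction rule: path_length.induct)
  case (segment q e x m y)
  then show ?case
    using path_length.segment[of G p e x "l + m" y] by (simp add: add.assoc)
qed simp

lemma path_length_lipschitz:
  assumes "edge_lipschitz G L f" "path_length G p q l"
  shows "norm (f p - f q) \<le> L * l"
  using assms(2)
proof (induction rule: path_length.induct)
  case (segment p e x l y)
  have "norm (f p - f (edge_point G e y)) \<le>
      norm (f p - f (edge_point G e x)) + norm (f (edge_point G e x) - f (edge_point G e y))"
    using norm_triangle_ineq[of "f p - f (edge_point G e x)" "f (edge_point G e x) - f (edge_point G e y)"] by simp
  also have "\<dots> \<le> L * l + L * \<bar>x - y\<bar>"
    using segment assms(1) by (intro add_mono) (auto simp: edge_lipschitz_def)
  finally show ?case by (simp add: algebra_simps)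
qed simp

lemma in_Lp_cong: "(\<And>x. x \<in> {0..1} \<Longrightarrow> f x = g x) \<Longrightarrow> in_Lp p f \<longleftrightarrow> in_Lp p g"
  unfolding in_Lp_def by (intro arg_cong2[of _ _ _ _ "(\<and>)"] measurable_cong Bochner_Integration.integrable_cong) auto

lemma Lp_mass_cong: "(\<And>x. x \<in> {0..1} \<Longrightarrow> f x = g x) \<Longrightarrow> Lp_mass p f = Lp_mass p g"
  unfolding Lp_mass_def by (intro Bochner_Integration.integral_cong) auto

text \<open>Tonelli with finite fibres, needed to sum over pairs of a vertex and an incident edge in
  either order.\<close>

lemma summable_on_Sigma_finite_iff:
  fixes f :: "'a \<times> 'b \<Rightarrow> real"
  assumes "\<And>x. x \<in> A \<Longrightarrow> finite (B x)" "\<And>x y. x \<in> A \<Longrightarrow> y \<in> B x \<Longrightarrow> 0 \<le> f (x, y)"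
  shows "f summable_on Sigma A B \<longleftrightarrow> (\<lambda>x. \<Sum>y\<in>B x. f (x, y)) summable_on A"
proof
  assume "f summable_on Sigma A B"
  then have "(\<lambda>x. infsum (\<lambda>y. f (x, y)) (B x)) summable_on A"
    using summable_on_Sigma_banach[of "\<lambda>x y. f (x, y)" A B] by simp
  then show "(\<lambda>x. \<Sum>y\<in>B x. f (x, y)) summable_on A"
    by (rule summable_on_cong[THEN iffD1, rotated]) (simp add: assms)
next
  assume "(\<lambda>x. \<Sum>y\<in>B x. f (x, y)) summable_on A"
  then show "f summable_on Sigma A B"
    by (intro summable_on_SigmaI[where g = "\<lambda>x. \<Sum>y\<in>B x. f (x, y)"]) (use assms in auto)
qed

context weighted_graph begin

lemma edge_point_in_points: "e \<in> arcs G \<Longrightarrow> x \<in> {0..1} \<Longrightarrow> edge_point G e x \<in> points G"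
  by (auto simp: edge_point_def)

text \<open>Connectedness is that of the undirected graph: a walk may traverse an edge against its
  orientation, hence the equivalence in \<open>step\<close>.\<close>

lemma vertex_propagation:
  assumes "u \<in> verts G" "v \<in> verts G" "P u" and step: "\<And>e. e \<in> arcs G \<Longrightarrow> P (tail G e) \<longleftrightarrow> P (head G e)"
  shows "P v"
proof -
  have "u \<rightarrow>\<^sup>*\<^bsub>with_proj (mk_symmetric G)\<^esub> v"
    using connected_graph assms(1,2)
    by (simp add: Digraph_Component.connected_def strongly_connected_def)
  then have "(u, v) \<in> rtrancl_on (verts G) (parcs (mk_symmetric G))"
    by (simp add: reachable_def)
  then show ?thesis
    by (induction rule: rtrancl_on_induct) (use assms(3) step in \<open>auto simp: parcs_mk_symmetric\<close>)
qed

lemma vertex_on_edge: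
  assumes "v \<in> verts G"
  obtains e where "e \<in> arcs G" "tail G e = v \<or> head G e = v"
proof -
  obtain e0 where e0: "e0 \<in> arcs G" using arcs_nonempty by blast
  \<comment> \<open>Both ends of any edge have this property, so it propagates from an end of
    \<open>e0\<close> to every vertex.\<close>
  have "\<exists>e\<in>arcs G. tail G e = v \<or> head G e = v"
    by (rule vertex_propagation[of "tail G e0" v "\<lambda>v. \<exists>e\<in>arcs G. tail G e = v \<or> head G e = v"])
      (use e0 assms in auto)
  then show ?thesis using that by blast
qed

lemma points_cases:
  assumes "p \<in> points G"
  obtains e x where "e \<in> arcs G" "x \<in> {0..1}" "p = edge_point G e x"
proof (cases p)
  case (Vertex v)
  then obtain e where "e \<in> arcs G" "tail G e = v \<or> head G e = v"
    using assms vertex_on_edge by auto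
  then show ?thesis using that[of e 0] that[of e 1] Vertex by auto
next
  case (Inner e x)
  then show ?thesis using that[of e x] assms by auto
qed

lemma path_length_in_points: "path_length G p q l \<Longrightarrow> p \<in> points G \<and> q \<in> points G"
  by (induction rule: path_length.induct) (auto simp: edge_point_in_points)

lemma path_length_edge:
  assumes "e \<in> arcs G" "x \<in> {0..1}" "y \<in> {0..1}"
  shows "path_length G (edge_point G e x) (edge_point G e y) \<bar>x - y\<bar>"
  using path_length.segment[OF path_length.trivial[OF edge_point_in_points[OF assms(1,2)]] assms] by simp

lemma path_length_sym: "path_length G p q l \<Longrightarrow> path_length G q p l"
proof (induction rule: path_length.induct)
  case (segment p e x l y)
  then have "path_length G (edge_point G e y) p (\<bar>y - x\<bar> + l)"
    by (intro path_length_trans[OF segment.IH] path_length_edge) auto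
  then show ?case by (simp add: abs_minus_commute add.commute)
qed (rule path_length.trivial)

lemma path_exists:
  assumes "p \<in> points G" "q \<in> points G"
  obtains l where "path_length G p q l"
proof -
  have edge: "\<exists>l. path_length G (edge_point G e x) (edge_point G e y) l"
    if "e \<in> arcs G" "x \<in> {0..1}" "y \<in> {0..1}" for e x y
    using path_length_edge[OF that] by blast
  obtain e x where e: "e \<in> arcs G" "x \<in> {0..1}" "p = edge_point G e x" using assms(1) by (rule points_cases)
  obtain e' x' where e': "e' \<in> arcs G" "x' \<in> {0..1}" "q = edge_point G e' x'" using assms(2) by (rule points_cases)
  have "\<exists>l. path_length G p (Vertex (tail G e')) l"
  proof (rule vertex_propagation[of "tail G e" "tail G e'" "\<lambda>v. \<exists>l. path_length G p (Vertex v) l"])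
    show "\<exists>l. path_length G p (Vertex (tail G e)) l" using edge[OF e(1,2), of 0] e(3) by simp
    fix a assume a: "a \<in> arcs G"
    show "(\<exists>l. path_length G p (Vertex (tail G a)) l) \<longleftrightarrow> (\<exists>l. path_length G p (Vertex (head G a)) l)"
      using edge[OF a, of 0 1] edge[OF a, of 1 0] path_length_trans by fastforce
  qed (use e e' in auto)
  moreover have "\<exists>l. path_length G (Vertex (tail G e')) q l" using edge[OF e'(1), of 0 x'] e' by simp
  ultimately show ?thesis using that path_length_trans by blast
qed

lemma path_dist_eq:
  "p \<in> points G \<Longrightarrow> q \<in> points G \<Longrightarrow> path_dist G p q = Inf {l. path_length G p q l}"
  by (simp add: path_dist_def)

lemma path_dist_le: "path_length G p q l \<Longrightarrow> path_dist G p q \<le> l"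
  using path_length_in_points[of p q l] path_length_nonneg
  by (auto simp: path_dist_eq intro!: cInf_lower bdd_belowI[of _ 0])

lemma path_dist_greatest:
  assumes "p \<in> points G" "q \<in> points G" "\<And>l. path_length G p q l \<Longrightarrow> b \<le> l"
  shows "b \<le> path_dist G p q"
  unfolding path_dist_eq[OF assms(1,2)]
proof (rule cInf_greatest)
  show "{l. path_length G p q l} \<noteq> {}" using path_exists[OF assms(1,2)] by blast
qed (use assms(3) in auto)

lemma path_dist_nonneg: "0 \<le> path_dist G p q"
proof (cases "p \<in> points G \<and> q \<in> points G")
  case True
  then show ?thesis by (intro path_dist_greatest path_length_nonneg) auto
qed (auto simp: path_dist_def)

lemma edge_lipschitz_dist:
  assumes "edge_lipschitz G L f" "L > 0" "p \<in> points G" "q \<in> points G"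
  shows "norm (f p - f q) \<le> L * path_dist G p q"
proof -
  have "norm (f p - f q) / L \<le> path_dist G p q"
    by (rule path_dist_greatest)
      (use path_length_lipschitz[OF assms(1)] assms in \<open>auto simp: divide_le_eq mult.commute\<close>)
  then show ?thesis using assms(2) by (simp add: divide_le_eq mult.commute)
qed

text \<open>The absence of loops enters at the end points: for an edge starting at \<open>v\<close>,
  the value 1 at \<open>x = 1\<close> is right because its head is another vertex.\<close>

lemma vertex_gauge_edge_point:
  assumes "e \<in> arcs G" "x \<in> {0..1}"
  shows "vertex_gauge G v (edge_point G e x) =
    (if tail G e = v then x else if head G e = v then 1 - x else 1)"
  using assms no_loops[OF assms(1)] by (auto simp: vertex_gauge_def edge_point_def)

lemma vertex_gauge_lipschitz: "edge_lipschitz G 1 (vertex_gauge G v)"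
  by (auto simp: edge_lipschitz_def vertex_gauge_edge_point simp del: atLeastAtMost_iff)

lemma edge_gauge_lipschitz: "edge_lipschitz G 1 (edge_gauge e)"
  by (auto simp: edge_lipschitz_def edge_gauge_def edge_point_def)

text \<open>An infimum of path lengths is at first only a pseudometric. The gauges are 1-Lipschitz,
  hence equal at points of distance zero, and they separate points: a vertex is the only zero of its
  gauge, an inner point is found from the gauge of its edge and that of the tail.\<close>

lemma path_dist_zero_imp_eq:
  assumes "p \<in> points G" "q \<in> points G" "path_dist G p q = 0"
  shows "p = q"
proof -
  have V: "vertex_gauge G v p = vertex_gauge G v q" for v
    using edge_lipschitz_dist[OF vertex_gauge_lipschitz _ assms(1,2)] assms(3) by simp
  have E: "edge_gauge e p = edge_gauge e q" for e
    using edge_lipschitz_dist[OF edge_gauge_lipschitz _ assms(1,2)] assms(3) by simp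
  show ?thesis
  proof (cases p)
    case (Vertex v)
    then show ?thesis using V[of v] assms by (cases q) (auto simp: vertex_gauge_def split: if_splits)
  next
    case (Inner e x)
    then obtain y where "q = Inner e y"
      using E[of e] assms by (cases q) (auto simp: edge_gauge_def split: if_splits)
    then show ?thesis using V[of "tail G e"] Inner by (simp add: vertex_gauge_def)
  qed
qed

lemma path_dist_commute: "path_dist G p q = path_dist G q p"
proof -
  have "{l. path_length G p q l} = {l. path_length G q p l}" using path_length_sym by blast
  then show ?thesis by (simp add: path_dist_def)
qed

lemma path_metric: "Metric_space (points G) (path_dist G)"
proof
  show "path_dist G p q = 0 \<longleftrightarrow> p = q" if "p \<in> points G" "q \<in> points G" for p q
  proof
    assume "p = q"
    then show "path_dist G p q = 0"
      using path_dist_le[OF path_length.trivial[OF that(1)]] path_dist_nonneg[of p q] by simp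
  qed (rule path_dist_zero_imp_eq[OF that])
  show "path_dist G p r \<le> path_dist G p q + path_dist G q r"
    if pqr: "p \<in> points G" "q \<in> points G" "r \<in> points G" for p q r
  proof -
    \<comment> \<open>The two infima are taken one after the other, first over paths from
      \<open>p\<close> to \<open>q\<close> with the path from \<open>q\<close> to \<open>r\<close>
      fixed.\<close>
    have "path_dist G p r - m \<le> path_dist G p q" if m: "path_length G q r m" for m
    proof (rule path_dist_greatest[OF pqr(1,2)])
      fix l assume "path_length G p q l"
      then show "path_dist G p r - m \<le> l" using path_dist_le[OF path_length_trans[OF m]] by fastforce
    qed
    then have "path_dist G p r - path_dist G p q \<le> path_dist G q r"
      by (intro path_dist_greatest[OF pqr(2,3)]) fastforce
    then show ?thesis by simp
  qed
qed (simp_all add: path_dist_nonneg path_dist_commute)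

sublocale path: Metric_space "points G" "path_dist G" by (rule path_metric)

lemma gtopology_eq: "gtopology G = path.mtopology" by (simp add: gtopology_def)

section \<open>Continuity and compactness in the path topology\<close>

lemma continuous_graph_iff:
  fixes f :: "('v, 'e) gpoint \<Rightarrow> 'a::real_normed_vector"
  shows "continuous_map (gtopology G) euclidean f \<longleftrightarrow> (\<forall>p\<in>points G. \<forall>\<epsilon>>0. \<exists>\<delta>>0. \<forall>q\<in>points G.
    path_dist G p q < \<delta> \<longrightarrow> norm (f p - f q) < \<epsilon>)"
  using path.metric_continuous_map[OF Met_TC.Metric_space_axioms, of f]
  by (simp add: gtopology_eq dist_norm Ball_def imp_conjL)

lemma edge_lipschitz_continuous:
  assumes "edge_lipschitz G L f" "L > 0"
  shows "continuous_map (gtopology G) euclidean f"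
  unfolding continuous_graph_iff
proof (intro ballI allI impI)
  fix p and \<epsilon> :: real assume p: "p \<in> points G" and "\<epsilon> > 0"
  have "norm (f p - f q) < \<epsilon>" if "q \<in> points G" "path_dist G p q < \<epsilon> / L" for q
  proof -
    have "norm (f p - f q) \<le> L * path_dist G p q" by (rule edge_lipschitz_dist[OF assms p that(1)])
    also have "\<dots> < \<epsilon>" using that(2) assms(2) by (simp add: less_divide_eq mult.commute)
    finally show ?thesis .
  qed
  then show "\<exists>\<delta>>0. \<forall>q\<in>points G. path_dist G p q < \<delta> \<longrightarrow> norm (f p - f q) < \<epsilon>"
    using \<open>\<epsilon> > 0\<close> assms(2) by (intro exI[of _ "\<epsilon> / L"]) auto
qed

lemma openin_star: "openin (gtopology G) {p \<in> points G. vertex_gauge G v p < 1}"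
proof -
  have "continuous_map (gtopology G) euclidean (vertex_gauge G v)"
    by (rule edge_lipschitz_continuous[OF vertex_gauge_lipschitz]) simp
  from openin_continuous_map_preimage[OF this, of "{..<1}"] show ?thesis
    by (simp add: gtopology_eq)
qed

lemma point_in_star:
  assumes "p \<in> points G"
  obtains v where "v \<in> verts G" "vertex_gauge G v p < 1"
proof (cases p)
  case (Vertex v)
  then show ?thesis using that[of v] assms by (simp add: vertex_gauge_def)
next
  case (Inner e x)
  then show ?thesis using that[of "tail G e"] assms by (simp add: vertex_gauge_def)
qed

lemma continuous_on_graph_local:
  assumes "\<And>v. v \<in> verts G \<Longrightarrow> \<exists>f. continuous_on_graph G f \<and>
      (\<forall>p\<in>points G. vertex_gauge G v p < 1 \<longrightarrow> u p = f p)"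
  shows "continuous_on_graph G u"
  unfolding continuous_on_graph_def continuous_graph_iff
proof (intro ballI allI impI)
  fix p and \<epsilon> :: real assume p: "p \<in> points G" and "\<epsilon> > 0"
  obtain v where v: "v \<in> verts G" "vertex_gauge G v p < 1" using p by (rule point_in_star)
  obtain f where f: "continuous_on_graph G f" "\<And>p. p \<in> points G \<Longrightarrow> vertex_gauge G v p < 1 \<Longrightarrow> u p = f p"
    using assms[OF v(1)] by blast
  obtain \<delta> where \<delta>: "\<delta> > 0" "\<And>q. q \<in> points G \<Longrightarrow> path_dist G p q < \<delta> \<Longrightarrow> norm (f p - f q) < \<epsilon>"
    using f(1) p \<open>\<epsilon> > 0\<close> unfolding continuous_on_graph_def continuous_graph_iff by meson
  \<comment> \<open>Since the gauge is 1-Lipschitz, the second bound in the minimum keeps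
    \<open>q\<close> in the open star of \<open>v\<close>, where \<open>u\<close> and
    \<open>f\<close> agree.\<close>
  have "norm (u p - u q) < \<epsilon>" if q: "q \<in> points G" "path_dist G p q < min \<delta> (1 - vertex_gauge G v p)" for q
  proof -
    have "norm (vertex_gauge G v p - vertex_gauge G v q) \<le> 1 * path_dist G p q"
      by (rule edge_lipschitz_dist[OF vertex_gauge_lipschitz _ p q(1)]) simp
    then have "vertex_gauge G v q < 1" using q(2) by (simp add: abs_le_iff)
    then show ?thesis using f(2)[OF p v(2)] f(2)[OF q(1)] \<delta>(2)[OF q(1)] q(2) by simp
  qed
  then show "\<exists>\<delta>>0. \<forall>q\<in>points G. path_dist G p q < \<delta> \<longrightarrow> norm (u p - u q) < \<epsilon>"
    using \<delta>(1) v(2) by (intro exI[of _ "min \<delta> (1 - vertex_gauge G v p)"]) auto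
qed

text \<open>The open stars cover the graph and each contains a single vertex, so a finite subcover
  of \<open>K\<close> bounds the number of vertices in it.\<close>

lemma finite_vertices_in_compact:
  assumes "compactin (gtopology G) K"
  shows "finite {v \<in> verts G. Vertex v \<in> K}"
proof -
  let ?star = "\<lambda>v. {p \<in> points G. vertex_gauge G v p < 1}"
  have "K \<subseteq> points G" using compactin_subset_topspace[OF assms] by (simp add: gtopology_eq)
  then have "K \<subseteq> \<Union> (?star ` verts G)" by (blast elim: point_in_star)
  moreover have "\<forall>U \<in> ?star ` verts G. openin (gtopology G) U" using openin_star by blast
  ultimately obtain \<F> where \<F>: "finite \<F>" "\<F> \<subseteq> ?star ` verts G" "K \<subseteq> \<Union>\<F>"
    using assms unfolding compactin_def by meson
  then obtain F where F: "finite F" "\<F> = ?star ` F" using finite_subset_image by meson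
  have "{v \<in> verts G. Vertex v \<in> K} \<subseteq> F"
  proof clarify
    fix v assume "Vertex v \<in> K"
    then obtain w where "w \<in> F" "vertex_gauge G w (Vertex v :: ('v, 'e) gpoint) < 1" using \<F>(3) F(2) by auto
    then show "v \<in> F" by (simp add: vertex_gauge_def split: if_splits)
  qed
  then show ?thesis using F(1) by (rule finite_subset)
qed

lemma compactin_edge:
  assumes e: "e \<in> arcs G"
  shows "compactin (gtopology G) (edge_point G e ` {0..1})"
proof (rule image_compactin)
  show "compactin (top_of_set {0..1}) {0..1::real}" by (simp add: compactin_subtopology)
  show "continuous_map (top_of_set {0..1}) (gtopology G) (edge_point G e)"
    unfolding gtopology_eq path.continuous_map_to_metric
  proof (intro ballI allI impI)
    fix x \<epsilon> :: real assume x: "x \<in> topspace (top_of_set {0..1})" and "\<epsilon> > 0"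
    have "edge_point G e y \<in> path.mball (edge_point G e x) \<epsilon>" if "y \<in> {0..1} \<inter> ball x \<epsilon>" for y
      using path_dist_le[OF path_length_edge[OF e, of x y]] edge_point_in_points[OF e] that x
      by (auto simp: dist_real_def)
    then show "\<exists>U. openin (top_of_set {0..1}) U \<and> x \<in> U \<and>
        (\<forall>y\<in>U. edge_point G e y \<in> path.mball (edge_point G e x) \<epsilon>)"
      using x \<open>\<epsilon> > 0\<close> by (intro exI[of _ "{0..1} \<inter> ball x \<epsilon>"]) (auto intro: openin_open_Int)
  qed
qed

section \<open>Vertex weights and the discrete spaces\<close>

lemma finite_incident: "v \<in> verts G \<Longrightarrow> finite (incident G v)"
  using uniformly_locally_finite by blast

lemma vertex_weight_pos: "v \<in> verts G \<Longrightarrow> 0 < vertex_weight G c v"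
  unfolding vertex_weight_def
  by (rule sum_pos[OF finite_incident]) (auto simp: incident_def conductivity_pos elim: vertex_on_edge)

text \<open>Double counting of incident pairs: \<open>c e\<close> enters the weights of exactly the
  two ends of \<open>e\<close>, which are distinct as there are no loops.\<close>

lemma summable_vertices_iff_edges:
  assumes "\<And>v. v \<in> verts G \<Longrightarrow> 0 \<le> g v"
  shows "(\<lambda>v. g v * vertex_weight G c v) summable_on verts G \<longleftrightarrow>
    (\<lambda>e. c e * (g (tail G e) + g (head G e))) summable_on arcs G"
proof -
  have "(\<lambda>v. g v * vertex_weight G c v) summable_on verts G \<longleftrightarrow>
      (\<lambda>v. \<Sum>e\<in>incident G v. g (fst (v, e)) * c (snd (v, e))) summable_on verts G"
    by (simp add: vertex_weight_def sum_distrib_left)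
  also have "\<dots> \<longleftrightarrow> (\<lambda>(v, e). g v * c e) summable_on Sigma (verts G) (incident G)"
  proof (subst summable_on_Sigma_finite_iff)
    show "0 \<le> (case (v, e) of (v, e) \<Rightarrow> g v * c e)" if "v \<in> verts G" "e \<in> incident G v" for v e
      using that by (auto simp: incident_def assms less_imp_le[OF conductivity_pos])
  qed (simp_all add: finite_incident)
  also have "\<dots> \<longleftrightarrow> (\<lambda>(e, v). g v * c e) summable_on (SIGMA e:arcs G. {tail G e, head G e})"
  proof -
    have "bij_betw prod.swap (Sigma (verts G) (incident G)) (SIGMA e:arcs G. {tail G e, head G e})"
      by (rule bij_betwI[of _ _ _ prod.swap]) (auto simp: incident_def)
    from summable_on_reindex_bij_betw[OF this, of "\<lambda>(e, v). g v * c e"]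
    show ?thesis by (simp add: case_prod_unfold)
  qed
  also have "\<dots> \<longleftrightarrow> (\<lambda>e. \<Sum>v\<in>{tail G e, head G e}. g v * c e) summable_on arcs G"
    by (subst summable_on_Sigma_finite_iff) (auto simp: assms less_imp_le[OF conductivity_pos])
  also have "\<dots> \<longleftrightarrow> (\<lambda>e. c e * (g (tail G e) + g (head G e))) summable_on arcs G"
    by (rule summable_on_cong) (use no_loops in \<open>auto simp: algebra_simps\<close>)
  finally show ?thesis .
qed

text \<open>Operators are sets of pairs whose second component must also lie in the space, so an
  eigenpair requires this of the multiple of \<open>z\<close> as well.\<close>

lemma dspace_scale:
  assumes z: "z \<in> dspace G c X"
  shows "(\<lambda>v. k * z v) \<in> dspace G c X"
proof (cases X)
  case C0
  have "finite {v \<in> verts G. \<epsilon> \<le> norm (k * z v)}" if "\<epsilon> > 0" for \<epsilon>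
  proof (cases "k = 0")
    case False
    have "finite {v \<in> verts G. \<epsilon> / norm k \<le> norm (z v)}" using z C0 that False by (simp add: dspace_def)
    then show ?thesis using False by (simp add: norm_mult divide_le_eq mult.commute)
  qed (use that in simp)
  then show ?thesis using C0 by (simp add: dspace_def)
next
  case (Lp p)
  then have "(\<lambda>v. norm k powr p * (norm (z v) powr p * vertex_weight G c v)) summable_on verts G"
    using z by (intro summable_on_cmult_right) (simp add: dspace_def)
  then show ?thesis using Lp by (simp add: dspace_def norm_mult powr_mult mult.assoc)
next
  case BUC
  obtain B where B: "\<And>v. v \<in> verts G \<Longrightarrow> norm (z v) \<le> B" using z BUC by (auto simp: dspace_def bounded_iff)
  have "bounded ((\<lambda>v. k * z v) ` verts G)"
    unfolding bounded_iff by (intro exI[of _ "norm k * B"]) (auto simp: norm_mult B mult_left_mono)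
  then show ?thesis using BUC by (simp add: dspace_def)
qed

end


section \<open>Functions determined by their vertex values\<close>

text \<open>\<open>q\<close> stands for \<open>V\<^sub>0 - \<mu>\<close>; an eigenfunction is interpolating, that is, determined on each edge by its
  values at the end points.\<close>

locale graph_with_boundary_basis =
  weighted_graph G c + boundary_basis q \<alpha> \<alpha>' \<beta> \<beta>' C S s
  for G :: "('v, 'e) pre_digraph" and c q \<alpha> \<alpha>' \<beta> \<beta>' C S s
begin

definition interpolating :: "(('v, 'e) gpoint \<Rightarrow> complex) \<Rightarrow> bool" where
  "interpolating u \<longleftrightarrow> (\<forall>e\<in>arcs G. \<forall>x\<in>{0..1}.
     on_edge G u e x = u (Vertex (tail G e)) * \<alpha> x + u (Vertex (head G e)) * \<beta> x)"

definition extension :: "('v \<Rightarrow> complex) \<Rightarrow> ('v, 'e) gpoint \<Rightarrow> complex" where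
  "extension z p = (case p of Vertex v \<Rightarrow> z v | Inner e x \<Rightarrow> z (tail G e) * \<alpha> x + z (head G e) * \<beta> x)"

lemma extension_Vertex [simp]: "extension z (Vertex v) = z v"
  by (simp add: extension_def)

lemma interpolating_extension: "interpolating (extension z)"
  by (auto simp: interpolating_def extension_def on_edge_def edge_point_def \<alpha>(2,3) \<beta>(2,3))

lemma interpolating_edge_point:
  "interpolating u \<Longrightarrow> e \<in> arcs G \<Longrightarrow> x \<in> {0..1} \<Longrightarrow>
    u (edge_point G e x) = u (Vertex (tail G e)) * \<alpha> x + u (Vertex (head G e)) * \<beta> x"
  unfolding interpolating_def on_edge_def by blast

lemma interpolating_scale: "interpolating u \<Longrightarrow> interpolating (\<lambda>p. k * u p)"
  by (simp add: interpolating_def on_edge_def algebra_simps)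

lemma interpolating_bounds:
  obtains M where "M \<ge> 1"
    "\<And>u e x. interpolating u \<Longrightarrow> e \<in> arcs G \<Longrightarrow> x \<in> {0..1} \<Longrightarrow>
      norm (u (edge_point G e x)) \<le> M * (norm (u (Vertex (tail G e))) + norm (u (Vertex (head G e))))"
    "\<And>u B. interpolating u \<Longrightarrow> (\<And>v. v \<in> verts G \<Longrightarrow> norm (u (Vertex v)) \<le> B) \<Longrightarrow>
      edge_lipschitz G (2 * M * B) u"
proof -
  obtain M where M: "M \<ge> 1"
    "\<And>a b x. x \<in> {0..1} \<Longrightarrow> norm (a * \<alpha> x + b * \<beta> x) \<le> M * (norm a + norm b)"
    "\<And>a b x y. x \<in> {0..1} \<Longrightarrow> y \<in> {0..1} \<Longrightarrow>
      norm ((a * \<alpha> x + b * \<beta> x) - (a * \<alpha> y + b * \<beta> y)) \<le> M * (norm a + norm b) * \<bar>x - y\<bar>"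
    using basis_bounds by metis
  show ?thesis
  proof (rule that[OF M(1)])
    show "norm (u (edge_point G e x)) \<le> M * (norm (u (Vertex (tail G e))) + norm (u (Vertex (head G e))))"
      if "interpolating u" "e \<in> arcs G" "x \<in> {0..1}" for u e x
      using M(2)[OF that(3)] by (simp add: interpolating_edge_point[OF that])
    show "edge_lipschitz G (2 * M * B) u"
      if u: "interpolating u" and B: "\<And>v. v \<in> verts G \<Longrightarrow> norm (u (Vertex v)) \<le> B" for u B
      unfolding edge_lipschitz_def
    proof (intro ballI)
      fix e and x y :: real assume e: "e \<in> arcs G" and x: "x \<in> {0..1}" and y: "y \<in> {0..1}"
      have "norm (u (edge_point G e x) - u (edge_point G e y)) \<le>
          M * (norm (u (Vertex (tail G e))) + norm (u (Vertex (head G e)))) * \<bar>x - y\<bar>"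
        using M(3)[OF x y] by (simp add: interpolating_edge_point[OF u e] x y del: atLeastAtMost_iff)
      also have "\<dots> \<le> M * (B + B) * \<bar>x - y\<bar>"
        using B[OF tail_in_verts[OF e]] B[OF head_in_verts[OF e]] M(1)
        by (intro mult_right_mono mult_left_mono add_mono) auto
      finally show "norm (u (edge_point G e x) - u (edge_point G e y)) \<le> 2 * M * B * \<bar>x - y\<bar>" by simp
    qed
  qed
qed

lemma interpolating_lipschitz:
  assumes "interpolating u" "\<And>v. v \<in> verts G \<Longrightarrow> norm (u (Vertex v)) \<le> B"
  obtains L where "L > 0" "edge_lipschitz G L u" "\<And>p. p \<in> points G \<Longrightarrow> norm (u p) \<le> L"
proof -
  obtain M where M: "M \<ge> 1"
    "\<And>u e x. interpolating u \<Longrightarrow> e \<in> arcs G \<Longrightarrow> x \<in> {0..1} \<Longrightarrow>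
      norm (u (edge_point G e x)) \<le> M * (norm (u (Vertex (tail G e))) + norm (u (Vertex (head G e))))"
    "\<And>u B. interpolating u \<Longrightarrow> (\<And>v. v \<in> verts G \<Longrightarrow> norm (u (Vertex v)) \<le> B) \<Longrightarrow>
      edge_lipschitz G (2 * M * B) u"
    using interpolating_bounds by metis
  \<comment> \<open>Enlarged so that the Lipschitz constant is positive even when all vertex values
    vanish.\<close>
  let ?B = "\<bar>B\<bar> + 1"
  have B: "norm (u (Vertex v)) \<le> ?B" if "v \<in> verts G" for v using assms(2)[OF that] by linarith
  show ?thesis
  proof (rule that)
    show "2 * M * ?B > 0" using M(1) by (intro mult_pos_pos) auto
    show "edge_lipschitz G (2 * M * ?B) u" by (rule M(3)[OF assms(1) B])
    fix p assume "p \<in> points G"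
    then obtain e x where e: "e \<in> arcs G" "x \<in> {0..1}" and p: "p = edge_point G e x" by (rule points_cases)
    have "norm (u p) \<le> M * (norm (u (Vertex (tail G e))) + norm (u (Vertex (head G e))))"
      unfolding p by (rule M(2)[OF assms(1) e])
    also have "\<dots> \<le> M * (?B + ?B)"
      using B[OF tail_in_verts[OF e(1)]] B[OF head_in_verts[OF e(1)]] M(1)
      by (intro mult_left_mono add_mono) auto
    finally show "norm (u p) \<le> 2 * M * ?B" by (simp add: algebra_simps)
  qed
qed

text \<open>Vertex values in \<open>\<ell>\<^sup>p\<close> may be unbounded because \<open>c\<close> is not bounded below, so \<open>u\<close> need not be
  Lipschitz; near \<open>v\<close> it agrees with an interpolating function supported near \<open>v\<close>.\<close>

lemma interpolating_continuous:
  assumes u: "interpolating u"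
  shows "continuous_on_graph G u"
proof (rule continuous_on_graph_local)
  fix v assume v: "v \<in> verts G"
  \<comment> \<open>The ends of all edges at \<open>v\<close>: on the open star of \<open>v\<close>
    only these vertex values matter, and as \<open>W\<close> is finite, the truncated values are
    bounded.\<close>
  define W where "W = tail G ` incident G v \<union> head G ` incident G v"
  define z where "z = (\<lambda>w. if w \<in> W then u (Vertex w) else 0)"
  have "finite W" unfolding W_def using finite_incident[OF v] by simp
  have "norm (extension z (Vertex w)) \<le> (\<Sum>w\<in>W. norm (u (Vertex w)))" for w
    using member_le_sum[OF _ _ \<open>finite W\<close>, of w "\<lambda>w. norm (u (Vertex w))"]
    by (auto simp: z_def sum_nonneg)
  then obtain L where "L > 0" "edge_lipschitz G L (extension z)"
    using interpolating_lipschitz[OF interpolating_extension] by metis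
  then have "continuous_on_graph G (extension z)"
    unfolding continuous_on_graph_def by (intro edge_lipschitz_continuous)
  moreover have "u p = extension z p" if p: "p \<in> points G" and gauge: "vertex_gauge G v p < 1" for p
  proof -
    obtain e x where e: "e \<in> arcs G" "x \<in> {0..1}" "p = edge_point G e x" using p by (rule points_cases)
    then have "e \<in> incident G v"
      using gauge by (auto simp: vertex_gauge_edge_point incident_def split: if_splits)
    then have "tail G e \<in> W" "head G e \<in> W" by (auto simp: W_def)
    then show ?thesis
      by (simp only: e(3) interpolating_edge_point[OF u e(1,2)] extension_Vertex
          interpolating_edge_point[OF interpolating_extension e(1,2)] z_def if_True)
  qed
  ultimately show "\<exists>f. continuous_on_graph G f \<and> (\<forall>p\<in>points G. vertex_gauge G v p < 1 \<longrightarrow> u p = f p)"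
    by blast
qed

section \<open>Membership in the function spaces in terms of vertex values\<close>

lemma interpolating_C0_iff:
  assumes u: "interpolating u"
  shows "u \<in> cspace G c C0 \<longleftrightarrow> (\<lambda>v. u (Vertex v)) \<in> dspace G c C0"
proof
  assume C0: "u \<in> cspace G c C0"
  have "finite {v \<in> verts G. \<epsilon> \<le> norm (u (Vertex v))}" if "\<epsilon> > 0" for \<epsilon>
  proof -
    obtain K where K: "compactin (gtopology G) K" "\<forall>p\<in>points G - K. norm (u p) < \<epsilon>"
      using C0 \<open>\<epsilon> > 0\<close> unfolding cspace_def by simp blast
    have "Vertex v \<in> K" if "v \<in> verts G" "\<epsilon> \<le> norm (u (Vertex v))" for v
    proof (rule ccontr)
      assume "Vertex v \<notin> K"
      then show False using bspec[OF K(2), of "Vertex v"] that by simp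
    qed
    then show ?thesis by (intro finite_subset[OF _ finite_vertices_in_compact[OF K(1)]]) auto
  qed
  then show "(\<lambda>v. u (Vertex v)) \<in> dspace G c C0" by (simp add: dspace_def)
next
  assume C0: "(\<lambda>v. u (Vertex v)) \<in> dspace G c C0"
  obtain M where M: "M \<ge> 1"
    "\<And>u e x. interpolating u \<Longrightarrow> e \<in> arcs G \<Longrightarrow> x \<in> {0..1} \<Longrightarrow>
      norm (u (edge_point G e x)) \<le> M * (norm (u (Vertex (tail G e))) + norm (u (Vertex (head G e))))"
    using interpolating_bounds by metis
  have "\<exists>K. compactin (gtopology G) K \<and> (\<forall>p\<in>points G - K. norm (u p) < \<epsilon>)" if \<epsilon>: "\<epsilon> > 0" for \<epsilon>
  proof -
    \<comment> \<open>Two end values below this threshold keep the function below \<epsilon> on the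
      whole edge, by the factor \<open>M\<close>.\<close>
    define F where "F = {v \<in> verts G. \<epsilon> / (2 * M) \<le> norm (u (Vertex v))}"
    have "0 < \<epsilon> / (2 * M)" using \<epsilon> M(1) by simp
    then have "finite F" using C0 by (simp add: dspace_def F_def)
    then have fin: "finite (\<Union>v\<in>F. incident G v)" by (auto simp: F_def finite_incident)
    \<comment> \<open>All closed edges touching \<open>F\<close>: a finite union of compact sets,
      outside of which no edge has an end in \<open>F\<close>.\<close>
    define K where "K = (\<Union>e\<in>(\<Union>v\<in>F. incident G v). edge_point G e ` {0..1})"
    have "compactin (gtopology G) K"
      unfolding K_def using fin by (intro compactin_Union) (auto simp: incident_def intro: compactin_edge)
    moreover have "norm (u p) < \<epsilon>" if p: "p \<in> points G - K" for p
    proof -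
      obtain e x where e: "e \<in> arcs G" "x \<in> {0..1}" and pe: "p = edge_point G e x"
        using p by (blast elim: points_cases)
      have "e \<notin> incident G v" if "v \<in> F" for v using p that e(2) unfolding K_def pe by blast
      then have "tail G e \<notin> F" "head G e \<notin> F" using e(1) by (auto simp: incident_def)
      then have "norm (u (Vertex (tail G e))) < \<epsilon> / (2 * M)" "norm (u (Vertex (head G e))) < \<epsilon> / (2 * M)"
        using e(1) by (auto simp: F_def)
      then have "M * (norm (u (Vertex (tail G e))) + norm (u (Vertex (head G e)))) <
          M * (\<epsilon> / (2 * M) + \<epsilon> / (2 * M))"
        using M(1) by (intro mult_strict_left_mono add_strict_mono) auto
      also have "\<dots> = \<epsilon>" using M(1) by (simp add: field_simps)
      finally show ?thesis using M(2)[OF u e] unfolding pe by linarith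
    qed
    ultimately show ?thesis by blast
  qed
  then show "u \<in> cspace G c C0" by (simp add: cspace_def interpolating_continuous[OF u])
qed

lemma interpolating_BUC_iff:
  assumes u: "interpolating u"
  shows "u \<in> cspace G c BUC \<longleftrightarrow> (\<lambda>v. u (Vertex v)) \<in> dspace G c BUC"
proof
  assume "u \<in> cspace G c BUC"
  then have "bounded (u ` points G)" by (simp add: cspace_def)
  then have "bounded ((\<lambda>v. u (Vertex v)) ` verts G)" by (rule bounded_subset) auto
  then show "(\<lambda>v. u (Vertex v)) \<in> dspace G c BUC" by (simp add: dspace_def)
next
  assume "(\<lambda>v. u (Vertex v)) \<in> dspace G c BUC"
  then obtain B where "\<And>v. v \<in> verts G \<Longrightarrow> norm (u (Vertex v)) \<le> B"
    by (auto simp: dspace_def bounded_iff)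
  then obtain L where L: "L > 0" "edge_lipschitz G L u" "\<And>p. p \<in> points G \<Longrightarrow> norm (u p) \<le> L"
    using interpolating_lipschitz[OF u] by metis
  have "\<exists>\<delta>>0. \<forall>p\<in>points G. \<forall>q\<in>points G. path_dist G p q < \<delta> \<longrightarrow> norm (u p - u q) < \<epsilon>"
    if "\<epsilon> > 0" for \<epsilon>
  proof (intro exI[of _ "\<epsilon> / L"] conjI ballI impI)
    fix p q assume pq: "p \<in> points G" "q \<in> points G" and d: "path_dist G p q < \<epsilon> / L"
    have "norm (u p - u q) \<le> L * path_dist G p q" by (rule edge_lipschitz_dist[OF L(2,1) pq])
    also have "\<dots> < \<epsilon>" using d L(1) by (simp add: less_divide_eq mult.commute)
    finally show "norm (u p - u q) < \<epsilon>" .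
  qed (use that L(1) in simp)
  moreover have "bounded (u ` points G)" using L(3) by (auto simp: bounded_iff)
  ultimately show "u \<in> cspace G c BUC" by (simp add: cspace_def)
qed

text \<open>On each edge the mass is comparable to the sum of the powers of the two end values, with
  constants independent of the edge; double counting then replaces edges by vertices.\<close>

lemma interpolating_Lp_iff:
  assumes u: "interpolating u" and p: "1 \<le> p"
  shows "u \<in> cspace G c (Lp p) \<longleftrightarrow> (\<lambda>v. u (Vertex v)) \<in> dspace G c (Lp p)"
proof -
  let ?f = "\<lambda>e x. u (Vertex (tail G e)) * \<alpha> x + u (Vertex (head G e)) * \<beta> x"
  let ?g = "\<lambda>v. norm (u (Vertex v)) powr p"
  have eq: "on_edge G u e x = ?f e x" if "e \<in> arcs G" "x \<in> {0..1}" for e x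
    using u that unfolding interpolating_def by blast
  have "in_Lp p (on_edge G u e)" if "e \<in> arcs G" for e
    using in_Lp_cong[OF eq[OF that]] continuous_in_Lp(1)[OF combination_continuous] p by simp
  then have "u \<in> cspace G c (Lp p) \<longleftrightarrow> (\<lambda>e. c e * Lp_mass p (on_edge G u e)) summable_on arcs G"
    by (simp add: cspace_def)
  also have "\<dots> \<longleftrightarrow> (\<lambda>e. c e * Lp_mass p (?f e)) summable_on arcs G"
    by (rule summable_on_cong) (simp only: Lp_mass_cong[OF eq])
  also have "\<dots> \<longleftrightarrow> (\<lambda>e. c e * (?g (tail G e) + ?g (head G e))) summable_on arcs G"
  proof
    obtain m where m: "m > 0"
      "\<And>a b. m * (norm a powr p + norm b powr p) \<le> Lp_mass p (\<lambda>x. a * \<alpha> x + b * \<beta> x)"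
      using Lp_mass_lower[OF p] by metis
    assume "(\<lambda>e. c e * Lp_mass p (?f e)) summable_on arcs G"
    then have "(\<lambda>e. 1 / m * (c e * Lp_mass p (?f e))) summable_on arcs G"
      by (rule summable_on_cmult_right)
    then show "(\<lambda>e. c e * (?g (tail G e) + ?g (head G e))) summable_on arcs G"
    proof (rule summable_on_comparison_test)
      fix e assume e: "e \<in> arcs G"
      have "c e * (m * (?g (tail G e) + ?g (head G e))) \<le> c e * Lp_mass p (?f e)"
        using conductivity_pos[OF e] by (intro mult_left_mono m) auto
      then show "c e * (?g (tail G e) + ?g (head G e)) \<le> 1 / m * (c e * Lp_mass p (?f e))"
        using m(1) by (simp add: field_simps)
      show "0 \<le> c e * (?g (tail G e) + ?g (head G e))" using conductivity_pos[OF e] by simp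
    qed
  next
    obtain K where K: "K \<ge> 0"
      "\<And>a b. Lp_mass p (\<lambda>x. a * \<alpha> x + b * \<beta> x) \<le> K * (norm a powr p + norm b powr p)"
      using Lp_mass_upper[OF p] by metis
    assume "(\<lambda>e. c e * (?g (tail G e) + ?g (head G e))) summable_on arcs G"
    then have "(\<lambda>e. K * (c e * (?g (tail G e) + ?g (head G e)))) summable_on arcs G"
      by (rule summable_on_cmult_right)
    then show "(\<lambda>e. c e * Lp_mass p (?f e)) summable_on arcs G"
    proof (rule summable_on_comparison_test)
      fix e assume e: "e \<in> arcs G"
      have "c e * Lp_mass p (?f e) \<le> c e * (K * (?g (tail G e) + ?g (head G e)))"
        using conductivity_pos[OF e] by (intro mult_left_mono K) auto
      then show "c e * Lp_mass p (?f e) \<le> K * (c e * (?g (tail G e) + ?g (head G e)))"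
        by (simp add: algebra_simps)
      have "0 \<le> Lp_mass p (?f e)" unfolding Lp_mass_def by (rule integral_nonneg_AE) simp
      then show "0 \<le> c e * Lp_mass p (?f e)" using conductivity_pos[OF e] by simp
    qed
  qed
  also have "\<dots> \<longleftrightarrow> (\<lambda>v. u (Vertex v)) \<in> dspace G c (Lp p)"
    by (simp add: dspace_def summable_vertices_iff_edges)
  finally show ?thesis .
qed

lemma interpolating_space_iff:
  assumes "interpolating u" "admissible X"
  shows "u \<in> cspace G c X \<longleftrightarrow> (\<lambda>v. u (Vertex v)) \<in> dspace G c X"
  using assms interpolating_C0_iff interpolating_BUC_iff interpolating_Lp_iff
  by (cases X) (auto simp: admissible_def)

text \<open>A nonzero interpolating function cannot be supported in the interiors of edges, as a
  Dirichlet eigenfunction could.\<close>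

lemma interpolating_nonzero_iff:
  assumes u: "interpolating u"
  shows "(\<exists>p\<in>points G. u p \<noteq> 0) \<longleftrightarrow> (\<exists>v\<in>verts G. u (Vertex v) \<noteq> 0)"
proof
  assume "\<exists>p\<in>points G. u p \<noteq> 0"
  then obtain p where "p \<in> points G" "u p \<noteq> 0" by blast
  moreover obtain e x where e: "e \<in> arcs G" "x \<in> {0..1}" "p = edge_point G e x"
    using \<open>p \<in> points G\<close> by (rule points_cases)
  ultimately have "u (Vertex (tail G e)) \<noteq> 0 \<or> u (Vertex (head G e)) \<noteq> 0"
    using interpolating_edge_point[OF u e(1,2)] by auto
  then show "\<exists>v\<in>verts G. u (Vertex v) \<noteq> 0" using e(1) by auto
next
  assume "\<exists>v\<in>verts G. u (Vertex v) \<noteq> 0"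
  then obtain v where "v \<in> verts G" "u (Vertex v) \<noteq> 0" by blast
  then show "\<exists>p\<in>points G. u p \<noteq> 0" by (intro bexI[of _ "Vertex v"]) simp_all
qed

text \<open>The boundary derivatives of \<open>\<alpha>\<close> and \<open>\<beta>\<close> turn \<open>s\<close> times the normal derivative into
  \<open>c(e) (z(v\<^sub>e) - C z(v))\<close> or \<open>c(e) (z(v\<^sub>e) - S z(v))\<close>, as \<open>e\<close> starts or ends at \<open>v\<close>.\<close>

lemma kirchhoff_iff:
  assumes v: "v \<in> verts G" and sym: "C = S \<or> balanced G c"
    and d: "\<And>e. e \<in> arcs G \<Longrightarrow> d e 0 = z (tail G e) * \<alpha>' 0 + z (head G e) * \<beta>' 0"
      "\<And>e. e \<in> arcs G \<Longrightarrow> d e 1 = z (tail G e) * \<alpha>' 1 + z (head G e) * \<beta>' 1"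
  shows "(\<Sum>e\<in>incident G v. normal_derivative G c (d e) e v) = 0 \<longleftrightarrow>
    (C + S) / 2 * z v = (\<Sum>e\<in>incident G v. of_real (c e / vertex_weight G c v) * z (opposite G v e))"
proof -
  let ?out = "{e \<in> arcs G. tail G e = v}" and ?in = "{e \<in> arcs G. head G e = v}"
  have inc: "incident G v = ?out \<union> ?in" by (auto simp: incident_def)
  have disj: "?out \<inter> ?in = {}" using no_loops by fastforce
  have fin: "finite ?out" "finite ?in" using finite_incident[OF v] unfolding inc by simp_all
  let ?k = "\<lambda>e. if v = tail G e then C else S"
  have nd: "s * normal_derivative G c (d e) e v = of_real (c e) * z (opposite G v e) - of_real (c e) * ?k e * z v"
    if "e \<in> incident G v" for e
    using that s_nonzero
    by (auto simp: incident_def normal_derivative_def opposite_def d \<alpha>(4,5) \<beta>(4,5) field_simps)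
  have weight: "(\<Sum>e\<in>incident G v. of_real (c e) * ?k e) = of_real (vertex_weight G c v) * ((C + S) / 2)"
  proof -
    have "(\<Sum>e\<in>incident G v. of_real (c e) * ?k e) =
        (\<Sum>e\<in>?out. of_real (c e) * ?k e) + (\<Sum>e\<in>?in. of_real (c e) * ?k e)"
      unfolding inc by (rule sum.union_disjoint[OF fin disj])
    also have "(\<Sum>e\<in>?out. of_real (c e) * ?k e) = of_real (\<Sum>e\<in>?out. c e) * C"
      by (simp add: sum_distrib_right)
    \<comment> \<open>An edge ending at \<open>v\<close> does not start there, so the conditional in
      \<open>?k\<close> yields \<open>S\<close>.\<close>
    also have "(\<Sum>e\<in>?in. of_real (c e) * ?k e) = (\<Sum>e\<in>?in. of_real (c e) * S)"
      by (rule sum.cong) (auto dest!: no_loops)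
    also have "\<dots> = of_real (\<Sum>e\<in>?in. c e) * S" by (simp add: sum_distrib_right)
    finally have *: "(\<Sum>e\<in>incident G v. of_real (c e) * ?k e) =
        of_real (\<Sum>e\<in>?out. c e) * C + of_real (\<Sum>e\<in>?in. c e) * S" .
    have "vertex_weight G c v = (\<Sum>e\<in>?out. c e) + (\<Sum>e\<in>?in. c e)"
      unfolding vertex_weight_def inc by (rule sum.union_disjoint[OF fin disj])
    moreover have "C = S \<or> (\<Sum>e\<in>?out. c e) = (\<Sum>e\<in>?in. c e)"
      using sym v by (auto simp: balanced_def)
    \<comment> \<open>The two sides differ by \<open>(a - b) * (C - S) / 2\<close>, which vanishes
      precisely under the stated alternative.\<close>
    moreover have "of_real a * C + of_real b * S = of_real (a + b) * ((C + S) / 2)"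
      if "C = S \<or> a = b" for a b :: real
      using that by (auto simp: field_simps)
    ultimately show ?thesis unfolding * by (simp only:)
  qed
  have pos: "vertex_weight G c v \<noteq> 0" using vertex_weight_pos[OF v] by simp
  have "s * (\<Sum>e\<in>incident G v. normal_derivative G c (d e) e v) =
      (\<Sum>e\<in>incident G v. of_real (c e) * z (opposite G v e)) - (\<Sum>e\<in>incident G v. of_real (c e) * ?k e) * z v"
    by (simp add: sum_distrib_left sum_distrib_right nd sum_subtractf)
  also have "(\<Sum>e\<in>incident G v. of_real (c e) * z (opposite G v e)) = of_real (vertex_weight G c v) *
      (\<Sum>e\<in>incident G v. of_real (c e / vertex_weight G c v) * z (opposite G v e))"
    using pos by (simp add: sum_distrib_left)
  finally have key: "s * (\<Sum>e\<in>incident G v. normal_derivative G c (d e) e v) = of_real (vertex_weight G c v) *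
      ((\<Sum>e\<in>incident G v. of_real (c e / vertex_weight G c v) * z (opposite G v e)) - (C + S) / 2 * z v)"
    unfolding weight by (simp add: algebra_simps)
  have "(\<Sum>e\<in>incident G v. normal_derivative G c (d e) e v) = 0 \<longleftrightarrow>
      s * (\<Sum>e\<in>incident G v. normal_derivative G c (d e) e v) = 0"
    using s_nonzero by simp
  then show ?thesis using pos unfolding key mult_eq_0_iff of_real_eq_0_iff right_minus_eq by argo
qed

end

section \<open>The correspondence of eigenvalues\<close>

lemma W21_cong:
  assumes "W21 \<psi> \<psi>' \<psi>''" "\<And>x. x \<in> {0..1} \<Longrightarrow> \<phi> x = \<psi> x"
  shows "W21 \<phi> \<psi>' \<psi>''"
  using assms unfolding W21_def by (metis has_vector_derivative_transform)

theorem corollary6p4: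
  fixes G :: "('v, 'e) pre_digraph"
    and c :: "'e \<Rightarrow> real"
    and X :: function_space
    and V :: "'e \<Rightarrow> real \<Rightarrow> complex"
    and V\<^sub>0 :: "real \<Rightarrow> complex"
    and \<mu> :: complex
  assumes "weighted_graph G c"
    and "admissible X"
    and "\<forall>e \<in> arcs G. V e absolutely_integrable_on {0..1}"
    and "\<exists>a. 0 \<le> a \<and> a < 1 \<and> relatively_bounded G c X V a"
    and "\<forall>e \<in> arcs G. AE x in lebesgue_on {0..1}. V e x = V\<^sub>0 x"
    and "symmetric_potential V\<^sub>0 \<or> balanced G c"
    and "\<mu> \<in> dirichlet_resolvent_set V\<^sub>0"
  shows "\<mu> \<in> point_spectrum (points G) (schroedinger G c X V) \<longleftrightarrow>
    floquet_discriminant V\<^sub>0 \<mu> \<in> point_spectrum (verts G) (transition G c X)"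
proof -
  interpret weighted_graph G c by fact
  obtain e0 where e0: "e0 \<in> arcs G" using arcs_nonempty by blast
  \<comment> \<open>Integrability is given for the potentials on the edges; \<open>V\<^sub>0\<close>
    agrees almost everywhere with the one on \<open>e0\<close>.\<close>
  have V0: "V\<^sub>0 absolutely_integrable_on {0..1}"
  proof (rule absolutely_integrable_spike)
    show "V e0 absolutely_integrable_on {0..1}" using assms(3) e0 by blast
    show "negligible {x \<in> {0..1}. \<not> V e0 x = V\<^sub>0 x}"
      using assms(5) e0 unfolding AE_lebesgue_on_iff_negligible by blast
  qed auto
  obtain \<alpha> \<alpha>' \<beta> \<beta>' C S s where basis: "boundary_basis (\<lambda>x. V\<^sub>0 x - \<mu>) \<alpha> \<alpha>' \<beta> \<beta>' C S s"
    and D: "floquet_discriminant V\<^sub>0 \<mu> = (C + S) / 2" and "symmetric_potential V\<^sub>0 \<longrightarrow> C = S"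
    by (rule boundary_basis_exists[OF V0 assms(7)])
  then have sym: "C = S \<or> balanced G c" using assms(6) by blast
  interpret graph_with_boundary_basis G c "\<lambda>x. V\<^sub>0 x - \<mu>" \<alpha> \<alpha>' \<beta> \<beta>' C S s
    using basis by (intro graph_with_boundary_basis.intro weighted_graph_axioms)
  show ?thesis
  proof
    assume "\<mu> \<in> point_spectrum (points G) (schroedinger G c X V)"
    then obtain u where u: "(u, \<lambda>p. \<mu> * u p) \<in> schroedinger G c X V" "\<exists>p\<in>points G. u p \<noteq> 0"
      unfolding point_spectrum_def by blast
    then obtain u' u'' where u': "\<And>e. e \<in> arcs G \<Longrightarrow> W21 (on_edge G u e) (u' e) (u'' e)"
      and repr: "represents G (\<lambda>p. \<mu> * u p) (\<lambda>e x. - u'' e x + V e x * on_edge G u e x)"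
      and kirchhoff: "\<And>v. v \<in> verts G \<Longrightarrow> (\<Sum>e\<in>incident G v. normal_derivative G c (u' e) e v) = 0"
      and uX: "u \<in> cspace G c X"
      unfolding schroedinger_def by blast
    \<comment> \<open>Replacing \<open>V e\<close> by \<open>V\<^sub>0\<close> off a null set makes
      all edges solve one and the same equation, so the common basis applies.\<close>
    have sol: "linear_solution (\<lambda>x. V\<^sub>0 x - \<mu>) (on_edge G u e) (u' e)" if e: "e \<in> arcs G" for e
    proof -
      have "AE x in lebesgue_on {0..1}. V e x = V\<^sub>0 x" using assms(5) e by blast
      moreover have "AE x in lebesgue_on {0..1}. on_edge G (\<lambda>p. \<mu> * u p) e x = - u'' e x + V e x * on_edge G u e x"
        using repr e by (simp add: represents_def)
      ultimately have "AE x in lebesgue_on {0..1}. - u'' e x + V\<^sub>0 x * on_edge G u e x = \<mu> * on_edge G u e x"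
        by eventually_elim (simp add: on_edge_def)
      then have "edge_solution V\<^sub>0 \<mu> (on_edge G u e) (u' e)"
        unfolding edge_solution_def using u'[OF e] by blast
      then show ?thesis using edge_solution_iff_linear_solution[OF V0] by blast
    qed
    have ends: "on_edge G u e 0 = u (Vertex (tail G e))" "on_edge G u e 1 = u (Vertex (head G e))" for e
      by (simp_all add: on_edge_def)
    have int: "interpolating u"
      unfolding interpolating_def using solution_boundary_values(1)[OF sol] by (simp add: ends)
    let ?z = "\<lambda>v. u (Vertex v)"
    have z: "?z \<in> dspace G c X" using interpolating_space_iff[OF int assms(2)] uX by blast
    have "(C + S) / 2 * ?z v =
        (\<Sum>e\<in>incident G v. of_real (c e / vertex_weight G c v) * ?z (opposite G v e))"
      if v: "v \<in> verts G" for v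
    proof -
      have "u' e 0 = ?z (tail G e) * \<alpha>' 0 + ?z (head G e) * \<beta>' 0"
        "u' e 1 = ?z (tail G e) * \<alpha>' 1 + ?z (head G e) * \<beta>' 1" if "e \<in> arcs G" for e
        using solution_boundary_values(2)[OF sol[OF that], of 0]
          solution_boundary_values(2)[OF sol[OF that], of 1] by (simp_all add: ends)
      from kirchhoff_iff[OF v sym this] kirchhoff[OF v] show ?thesis by blast
    qed
    then have "(?z, \<lambda>v. (C + S) / 2 * ?z v) \<in> transition G c X"
      using z dspace_scale[OF z, of "(C + S) / 2"] by (simp add: transition_def)
    then show "floquet_discriminant V\<^sub>0 \<mu> \<in> point_spectrum (verts G) (transition G c X)"
      using u(2) interpolating_nonzero_iff[OF int] unfolding D point_spectrum_def by blast
  next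
    assume "floquet_discriminant V\<^sub>0 \<mu> \<in> point_spectrum (verts G) (transition G c X)"
    then obtain z where z: "(z, \<lambda>v. (C + S) / 2 * z v) \<in> transition G c X" "\<exists>v\<in>verts G. z v \<noteq> 0"
      unfolding D point_spectrum_def by blast
    define u where "u = extension z"
    note int = interpolating_extension[of z, folded u_def]
    have uz: "u (Vertex v) = z v" for v by (simp add: u_def)
    have uX: "u \<in> cspace G c X" "(\<lambda>p. \<mu> * u p) \<in> cspace G c X"
      using z(1) dspace_scale[of z X \<mu>] interpolating_space_iff[OF int assms(2)]
        interpolating_space_iff[OF interpolating_scale[OF int, of \<mu>] assms(2)]
      by (simp_all add: transition_def uz)
    let ?u' = "\<lambda>e x. z (tail G e) * \<alpha>' x + z (head G e) * \<beta>' x"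
    have "\<forall>e\<in>arcs G. \<exists>w. W21 (on_edge G u e) (?u' e) w \<and>
        (AE x in lebesgue_on {0..1}. on_edge G (\<lambda>p. \<mu> * u p) e x = - w x + V e x * on_edge G u e x)"
    proof
      fix e assume e: "e \<in> arcs G"
      let ?\<psi> = "\<lambda>x. z (tail G e) * \<alpha> x + z (head G e) * \<beta> x"
      have eq: "on_edge G u e x = ?\<psi> x" if "x \<in> {0..1}" for x
        using int e that unfolding interpolating_def by (simp add: uz)
      have "edge_solution V\<^sub>0 \<mu> ?\<psi> (?u' e)"
        using combination edge_solution_iff_linear_solution[OF V0] by blast
      then obtain w where w: "W21 ?\<psi> (?u' e) w"
        "AE x in lebesgue_on {0..1}. - w x + V\<^sub>0 x * ?\<psi> x = \<mu> * ?\<psi> x"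
        unfolding edge_solution_def by blast
      have "AE x in lebesgue_on {0..1}. V e x = V\<^sub>0 x" using assms(5) e by blast
      \<comment> \<open>Restricts attention to \<open>x\<close> in [0,1], where \<open>eq\<close>
        identifies the extension with \<open>?\<psi>\<close>.\<close>
      moreover have "AE x in lebesgue_on {0..1}. x \<in> space (lebesgue_on {0..1::real})"
        by (rule AE_space)
      ultimately have "AE x in lebesgue_on {0..1}.
          on_edge G (\<lambda>p. \<mu> * u p) e x = - w x + V e x * on_edge G u e x"
        using w(2)
      proof eventually_elim
        case (elim x)
        then have "x \<in> {0..1}" by simp
        have "on_edge G (\<lambda>p. \<mu> * u p) e x = \<mu> * on_edge G u e x" by (simp add: on_edge_def)
        then show ?case unfolding eq[OF \<open>x \<in> {0..1}\<close>] using elim by simp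
      qed
      moreover have "W21 (on_edge G u e) (?u' e) w" by (rule W21_cong[OF w(1) eq])
      ultimately show "\<exists>w. W21 (on_edge G u e) (?u' e) w \<and>
          (AE x in lebesgue_on {0..1}. on_edge G (\<lambda>p. \<mu> * u p) e x = - w x + V e x * on_edge G u e x)"
        by blast
    qed
    from bchoice[OF this] obtain u'' where u'': "\<forall>e\<in>arcs G. W21 (on_edge G u e) (?u' e) (u'' e)"
      "represents G (\<lambda>p. \<mu> * u p) (\<lambda>e x. - u'' e x + V e x * on_edge G u e x)"
      unfolding represents_def by blast
    have "(\<Sum>e\<in>incident G v. normal_derivative G c (?u' e) e v) = 0" if v: "v \<in> verts G" for v
      using z(1) v kirchhoff_iff[OF v sym, of ?u' z] by (simp add: transition_def)
    then have "(u, \<lambda>p. \<mu> * u p) \<in> schroedinger G c X V"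
      unfolding schroedinger_def mem_Collect_eq prod.case
      using uX u'' interpolating_continuous[OF int]
      by (intro conjI exI[of _ ?u'] exI[of _ u'']) simp_all
    moreover have "\<exists>p\<in>points G. u p \<noteq> 0"
      using z(2) interpolating_nonzero_iff[OF int] by (simp add: uz)
    ultimately show "\<mu> \<in> point_spectrum (points G) (schroedinger G c X V)"
      unfolding point_spectrum_def by blast
  qed
qed

end
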